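(* Let $G=G([n],E)$ be a connected simple graph. Let $N>0$ with $N\neq n+|E|$, and let $N\Delta=\mathrm{conv}\{Ne_1,\dots,Ne_n\}\subseteq\mathbb{R}^{[n]}$. Let $\mathcal{Y}_G$ be the polytopal complex consisting of all nonempty faces of the polytope $[P_G,N\Delta]$ except the polytope itself and the facet $N\Delta$ (i.e. obtained from the join after removing its open $n$-dimensional cell and the relatively open $(n-1)$-dimensional cell corresponding to $N\Delta$). Then $\mathcal{Y}_G$ is a polytopal complex realization of the abstract cell complex $\mathscr{Y}_G$: there is a bijection between the (relatively open) cells of $\mathcal{Y}_G$ and the elements of $\mathscr{Y}_G$ under which containment of closures corresponds to $\preceq_y$ and affine dimension corresponds to $\dim_y$.
   Context: For $S,T\subseteq\mathbb{R}^{[n]}$ nonempty, the join $[S,T]$ is the set of all points $\alpha s+(1-\alpha)t$ with $\alpha\in[0,1]$, $s\in S$, $t\in T$. For a simple graph $G=G([n],E)$, let $P_G=\{x\in\mathbb{R}^{[n]}:\sum_{i\in[n]}x_i=n+|E|,\ \sum_{i\in\sigma}x_i\ge|\sigma|+|E(G[\sigma])|\ \forall\sigma\subseteq[n]\}$, where $G[\sigma]$ is the induced subgraph. Partial acyclic orientations: an orientation of a graph $H$ assigns to each edge $e=\{u,v\}$ one of $e$ (undirected), $(u,v)$, $(v,u)$. A partition $\Sigma$ of the vertex set is a connected partition if each block induces a connected subgraph; the partition graph $H^\Sigma$ has vertex set $\Sigma$, with distinct blocks adjacent iff some edge joins them. An orientation $O$ of $H$ is a p.a.o. if there are a connected partition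 $\Sigma$ and an acyclic orientation $O^\Sigma$ of $H^\Sigma$ (all edges oriented, no directed cycles) such that edges inside blocks are undirected and each edge $\{u,v\}$ with $u\in\sigma\neq\rho\ni v$ is oriented $(u,v)$ when $O^\Sigma$ orients $\{\sigma,\rho\}$ as $(\sigma,\rho)$. Put $\dim_H(O)=|V(H)|-|\Sigma|$, and let $J_H(O)$ be the collection of all unions $\bigcup_{\sigma\in I}\sigma$ over order ideals $I$ (including $\emptyset$) of the poset on $\Sigma$ induced by $O^\Sigma$. The abstract cell complex $\mathscr{Y}_G$ has as elements (a) all nonempty proper subsets $A\subsetneq[n]$, and (b) all pairs $(\sigma,O)$ with $\emptyset\neq\sigma\subseteq[n]$ and $O$ a p.a.o. of $G[\sigma]$. For distinct elements: $A\preceq_y B$ for subsets iff $A\subseteq B$; $A\preceq_y(\sigma,O)$ iff $A\subseteq[n]\setminus\sigma$; $(\sigma_0,O_0)\preceq_y(\sigma_1,O_1)$ iff $J_{G[\sigma_1]}(O_1)\subseteq J_{G[\sigma_0]}(O_0)$; no pair $(\sigma,O)$ is below a subset. Dimensions: $\dim_y(A)=|A|-1$ and $\dim_y(\sigma,O)=|[n]\setminus\sigma|+\dim_{G[\sigma]}(O)$. *)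

theory Defs
  imports "HOL-Analysis.Analysis" "HOL-Library.Disjoint_Sets" "HOL-Library.FuncSet"
begin

subsection \<open>Graphs\<close>

text \<open>A graph is given by a vertex set \<open>V\<close> and a set \<open>E\<close> of edges, each edge being a
  two-element set of vertices.\<close>

definition simple_graph :: "'a set \<Rightarrow> 'a set set \<Rightarrow> bool" where
  "simple_graph V E \<longleftrightarrow> finite V \<and> (\<forall>e\<in>E. e \<subseteq> V \<and> card e = 2)"

definition induced_edges :: "'a set set \<Rightarrow> 'a set \<Rightarrow> 'a set set" where
  "induced_edges E \<sigma> = {e \<in> E. e \<subseteq> \<sigma>}"

definition connected_graph :: "'a set \<Rightarrow> 'a set set \<Rightarrow> bool" where
  "connected_graph V E \<longleftrightarrow> V \<noteq> {} \<and> (\<forall>u\<in>V. \<forall>v\<in>V. (u, v) \<in> {(a, b). {a, b} \<in> E}\<^sup>*)"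

definition connected_partition :: "'a set \<Rightarrow> 'a set set \<Rightarrow> 'a set set \<Rightarrow> bool" where
  "connected_partition V E Q \<longleftrightarrow>
     partition_on V Q \<and> (\<forall>\<sigma>\<in>Q. connected_graph \<sigma> (induced_edges E \<sigma>))"

definition partition_graph_edges :: "'a set set \<Rightarrow> 'a set set \<Rightarrow> 'a set set set" where
  "partition_graph_edges E Q =
     {{\<sigma>, \<rho>} | \<sigma> \<rho>. \<sigma> \<in> Q \<and> \<rho> \<in> Q \<and> \<sigma> \<noteq> \<rho> \<and> (\<exists>u\<in>\<sigma>. \<exists>v\<in>\<rho>. {u, v} \<in> E)}"

subsection \<open>Orientations and partial acyclic orientations\<close>

text \<open>The value \<open>None\<close> means that the edge stays undirected, \<open>Some (u, v)\<close> that it is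
  directed from \<open>u\<close> to \<open>v\<close>. Orientations are extensional outside the edge set, so that
  equality of orientations is equality on edges.\<close>

type_synonym 'a orientation = "'a set \<Rightarrow> ('a \<times> 'a) option"

definition orientations :: "'a set set \<Rightarrow> 'a orientation set" where
  "orientations E = (\<Pi>\<^sub>E e\<in>E. insert None {Some (u, v) | u v. e = {u, v}})"

definition arcs :: "'a set set \<Rightarrow> 'a orientation \<Rightarrow> ('a \<times> 'a) set" where
  "arcs E d = {(u, v). \<exists>e\<in>E. d e = Some (u, v)}"

definition acyclic_orientation :: "'a set set \<Rightarrow> 'a orientation \<Rightarrow> bool" where
  "acyclic_orientation E d \<longleftrightarrow>
     d \<in> orientations E \<and> (\<forall>e\<in>E. d e \<noteq> None) \<and> acyclic (arcs E d)"

text \<open>\<open>Q\<close> and \<open>q\<close> are a connected partition and an acyclic orientation of its partition graph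
  that witness that \<open>d\<close> is a partial acyclic orientation of the graph \<open>(V, E)\<close>.\<close>

definition pao_witness ::
  "'a set \<Rightarrow> 'a set set \<Rightarrow> 'a orientation \<Rightarrow> 'a set set \<Rightarrow> 'a set orientation \<Rightarrow> bool" where
  "pao_witness V E d Q q \<longleftrightarrow>
     d \<in> orientations E \<and>
     connected_partition V E Q \<and>
     acyclic_orientation (partition_graph_edges E Q) q \<and>
     (\<forall>\<sigma>\<in>Q. \<forall>e\<in>E. e \<subseteq> \<sigma> \<longrightarrow> d e = None) \<and>
     (\<forall>\<sigma>\<in>Q. \<forall>\<rho>\<in>Q. \<forall>u\<in>\<sigma>. \<forall>v\<in>\<rho>.
        \<sigma> \<noteq> \<rho> \<and> {u, v} \<in> E \<and> q {\<sigma>, \<rho>} = Some (\<sigma>, \<rho>) \<longrightarrow> d {u, v} = Some (u, v))"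

definition pao :: "'a set \<Rightarrow> 'a set set \<Rightarrow> 'a orientation \<Rightarrow> bool" where
  "pao V E d \<longleftrightarrow> (\<exists>Q q. pao_witness V E d Q q)"

text \<open>The witnesses are unique on simple graphs, see \<open>pao_witness_unique\<close> below.\<close>

definition pao_partition :: "'a set \<Rightarrow> 'a set set \<Rightarrow> 'a orientation \<Rightarrow> 'a set set" where
  "pao_partition V E d = (THE Q. \<exists>q. pao_witness V E d Q q)"

definition pao_quotient :: "'a set \<Rightarrow> 'a set set \<Rightarrow> 'a orientation \<Rightarrow> 'a set orientation" where
  "pao_quotient V E d = (THE q. pao_witness V E d (pao_partition V E d) q)"

definition pao_dim :: "'a set \<Rightarrow> 'a set set \<Rightarrow> 'a orientation \<Rightarrow> int" where
  "pao_dim V E d = int (card V) - int (card (pao_partition V E d))"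

text \<open>In the poset induced by an acyclic orientation, \<open>a\<close> lies below \<open>b\<close> iff there is a directed
  path from \<open>a\<close> to \<open>b\<close>.\<close>

definition order_ideal :: "'a set \<Rightarrow> 'a set set \<Rightarrow> 'a orientation \<Rightarrow> 'a set \<Rightarrow> bool" where
  "order_ideal V E d I \<longleftrightarrow>
     I \<subseteq> V \<and> (\<forall>b\<in>I. \<forall>a\<in>V. (a, b) \<in> (arcs E d)\<^sup>* \<longrightarrow> a \<in> I)"

definition pao_ideals :: "'a set \<Rightarrow> 'a set set \<Rightarrow> 'a orientation \<Rightarrow> 'a set set" where
  "pao_ideals V E d =
     (let Q = pao_partition V E d; q = pao_quotient V E d
      in {\<Union> I | I. order_ideal Q (partition_graph_edges E Q) q I})"

subsection \<open>The abstract cell complex\<close>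

text \<open>The ground set \<open>[n]\<close> is the universe of a finite type.\<close>

datatype 'n ycell = Subset "'n set" | Oriented "'n set" "'n orientation"

definition ycells :: "'n::finite set set \<Rightarrow> 'n ycell set" where
  "ycells E = {Subset A | A. A \<noteq> {} \<and> A \<subset> UNIV} \<union>
     {Oriented \<sigma> d | \<sigma> d. \<sigma> \<noteq> {} \<and> pao \<sigma> (induced_edges E \<sigma>) d}"

fun yless_distinct :: "'n::finite set set \<Rightarrow> 'n ycell \<Rightarrow> 'n ycell \<Rightarrow> bool" where
  "yless_distinct E (Subset A) (Subset B) \<longleftrightarrow> A \<subseteq> B"
| "yless_distinct E (Subset A) (Oriented \<sigma> d) \<longleftrightarrow> A \<subseteq> UNIV - \<sigma>"
| "yless_distinct E (Oriented \<sigma>0 d0) (Oriented \<sigma>1 d1) \<longleftrightarrow>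
     pao_ideals \<sigma>1 (induced_edges E \<sigma>1) d1 \<subseteq> pao_ideals \<sigma>0 (induced_edges E \<sigma>0) d0"
| "yless_distinct E (Oriented \<sigma> d) (Subset A) \<longleftrightarrow> False"

definition yle :: "'n::finite set set \<Rightarrow> 'n ycell \<Rightarrow> 'n ycell \<Rightarrow> bool" where
  "yle E x y \<longleftrightarrow> x = y \<or> yless_distinct E x y"

fun ydim :: "'n::finite set set \<Rightarrow> 'n ycell \<Rightarrow> int" where
  "ydim E (Subset A) = int (card A) - 1"
| "ydim E (Oriented \<sigma> d) = int (card (UNIV - \<sigma>)) + pao_dim \<sigma> (induced_edges E \<sigma>) d"

subsection \<open>The polytopal complex\<close>

definition join :: "'v::real_vector set \<Rightarrow> 'v set \<Rightarrow> 'v set" where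
  "join S T = {\<alpha> *\<^sub>R s + (1 - \<alpha>) *\<^sub>R t | \<alpha> s t. 0 \<le> \<alpha> \<and> \<alpha> \<le> 1 \<and> s \<in> S \<and> t \<in> T}"

definition graph_polytope :: "'n::finite set set \<Rightarrow> (real ^ 'n) set" where
  "graph_polytope E =
     {x. (\<Sum>i\<in>UNIV. x $ i) = real (CARD('n) + card E) \<and>
         (\<forall>\<sigma>. (\<Sum>i\<in>\<sigma>. x $ i) \<ge> real (card \<sigma> + card (induced_edges E \<sigma>)))}"

definition dilated_simplex :: "real \<Rightarrow> (real ^ 'n) set" where
  "dilated_simplex N = convex hull (range (\<lambda>i. N *\<^sub>R axis i 1))"

definition polytopal_complex :: "'v::euclidean_space set set \<Rightarrow> bool" where
  "polytopal_complex C \<longleftrightarrow>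
     finite C \<and>
     (\<forall>S\<in>C. polytope S \<and> S \<noteq> {}) \<and>
     (\<forall>S\<in>C. \<forall>F. F face_of S \<and> F \<noteq> {} \<longrightarrow> F \<in> C) \<and>
     (\<forall>S\<in>C. \<forall>T\<in>C. (S \<inter> T) face_of S \<and> (S \<inter> T) face_of T)"

definition open_cells :: "'v::euclidean_space set set \<Rightarrow> 'v set set" where
  "open_cells C = rel_interior ` C"

definition Y_complex :: "'n::finite set set \<Rightarrow> real \<Rightarrow> (real ^ 'n) set set" where
  "Y_complex E N =
     {F. F face_of join (graph_polytope E) (dilated_simplex N) \<and> F \<noteq> {} \<and>
         F \<noteq> join (graph_polytope E) (dilated_simplex N) \<and> F \<noteq> dilated_simplex N}"

subsection \<open>Uniqueness of the witnesses of a partial acyclic orientation\<close>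

lemma partition_edge_oriented:
  assumes w: "pao_witness V E d Q q" and "\<sigma> \<in> Q" "\<rho> \<in> Q" "\<sigma> \<noteq> \<rho>" "u \<in> \<sigma>" "v \<in> \<rho>" "{u, v} \<in> E"
  shows "q {\<sigma>, \<rho>} = Some (\<sigma>, \<rho>) \<and> d {u, v} = Some (u, v) \<or>
         q {\<sigma>, \<rho>} = Some (\<rho>, \<sigma>) \<and> d {u, v} = Some (v, u)"
proof -
  have orient: "d {a, b} = Some (a, b)"
    if "\<mu> \<in> Q" "\<nu> \<in> Q" "a \<in> \<mu>" "b \<in> \<nu>" "\<mu> \<noteq> \<nu>" "{a, b} \<in> E" "q {\<mu>, \<nu>} = Some (\<mu>, \<nu>)" for \<mu> \<nu> a b
    using w that unfolding pao_witness_def by simp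
  have e: "{\<sigma>, \<rho>} \<in> partition_graph_edges E Q"
    using assms unfolding partition_graph_edges_def by blast
  have "acyclic_orientation (partition_graph_edges E Q) q"
    using w by (simp add: pao_witness_def)
  then have "q \<in> orientations (partition_graph_edges E Q)" "q {\<sigma>, \<rho>} \<noteq> None"
    using e by (simp_all add: acyclic_orientation_def)
  then have "q {\<sigma>, \<rho>} \<in> insert None {Some (u, v) | u v. {\<sigma>, \<rho>} = {u, v}}" "q {\<sigma>, \<rho>} \<noteq> None"
    using PiE_mem[OF _ e] unfolding orientations_def by blast+
  then consider "q {\<sigma>, \<rho>} = Some (\<sigma>, \<rho>)" | "q {\<sigma>, \<rho>} = Some (\<rho>, \<sigma>)"
    by (auto simp: doubleton_eq_iff)
  then show ?thesis
  proof cases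
    case 1
    then show ?thesis using orient[OF assms(2,3,5,6,4,7)] by simp
  next
    case 2
    then have "q {\<rho>, \<sigma>} = Some (\<rho>, \<sigma>)" "{v, u} \<in> E"
      using assms by (simp_all add: insert_commute)
    then have "d {v, u} = Some (v, u)"
      using orient[OF assms(3,2,6,5) assms(4)[symmetric]] by simp
    then show ?thesis using 2 by (simp add: insert_commute)
  qed
qed

lemma pao_witness_block:
  assumes g: "simple_graph V E" and w: "pao_witness V E d Q q" and \<sigma>: "\<sigma> \<in> Q" and u: "u \<in> \<sigma>"
  shows "\<sigma> = {v. (u, v) \<in> {(a, b). {a, b} \<in> E \<and> d {a, b} = None}\<^sup>*}"
    (is "_ = {v. _ \<in> ?R\<^sup>*}")
proof (intro equalityI subsetI CollectI)
  have part: "partition_on V Q"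
    using w by (simp add: pao_witness_def connected_partition_def)
  fix v assume v: "v \<in> \<sigma>"
  have "connected_graph \<sigma> (induced_edges E \<sigma>)"
    using w \<sigma> by (simp add: pao_witness_def connected_partition_def)
  then have "(u, v) \<in> {(a, b). {a, b} \<in> induced_edges E \<sigma>}\<^sup>*"
    using u v unfolding connected_graph_def by blast
  moreover have "{(a, b). {a, b} \<in> induced_edges E \<sigma>} \<subseteq> ?R"
    using w \<sigma> by (auto simp: pao_witness_def induced_edges_def)
  ultimately show "(u, v) \<in> ?R\<^sup>*" using rtrancl_mono by blast
next
  have part: "partition_on V Q"
    using w by (simp add: pao_witness_def connected_partition_def)
  fix v assume "v \<in> {v. (u, v) \<in> ?R\<^sup>*}"
  then have "(u, v) \<in> ?R\<^sup>*" by simp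
  then show "v \<in> \<sigma>"
  proof induction
    case base
    show ?case by (rule u)
  next
    case (step a b)
    then have e: "{a, b} \<in> E" "d {a, b} = None" by auto
    then have "b \<in> V" using g unfolding simple_graph_def by blast
    then obtain \<rho> where \<rho>: "\<rho> \<in> Q" "b \<in> \<rho>"
      using part by (auto simp: partition_on_def)
    have "\<rho> = \<sigma>"
      using partition_edge_oriented[OF w \<sigma> \<rho>(1) _ step.IH \<rho>(2) e(1)] e(2) by auto
    then show ?case using \<rho> by simp
  qed
qed

lemma pao_witness_unique:
  assumes g: "simple_graph V E" and w: "pao_witness V E d Q q" and w': "pao_witness V E d Q' q'"
  shows "Q = Q' \<and> q = q'"
proof -
  have sub: "A \<subseteq> B" if "pao_witness V E d A a" "pao_witness V E d B b" for A B a b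
  proof
    fix \<sigma> assume \<sigma>: "\<sigma> \<in> A"
    have pA: "partition_on V A" and pB: "partition_on V B"
      using that by (simp_all add: pao_witness_def connected_partition_def)
    obtain u where u: "u \<in> \<sigma>" using pA \<sigma> by (metis partition_onD3 ex_in_conv)
    then have "u \<in> V" using pA \<sigma> by (auto simp: partition_on_def)
    then obtain \<rho> where \<rho>: "\<rho> \<in> B" "u \<in> \<rho>" using pB by (auto simp: partition_on_def)
    have "\<sigma> = \<rho>"
      using pao_witness_block[OF g that(1) \<sigma> u] pao_witness_block[OF g that(2) \<rho>] by simp
    then show "\<sigma> \<in> B" using \<rho> by simp
  qed
  have Q: "Q = Q'" using sub[OF w w'] sub[OF w' w] by blast
  have "q = q'"
  proof
    fix e
    show "q e = q' e"
    proof (cases "e \<in> partition_graph_edges E Q")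
      case True
      then obtain \<sigma> \<rho> u v where *: "e = {\<sigma>, \<rho>}" "\<sigma> \<in> Q" "\<rho> \<in> Q" "\<sigma> \<noteq> \<rho>" "u \<in> \<sigma>" "v \<in> \<rho>" "{u, v} \<in> E"
        unfolding partition_graph_edges_def by blast
      have "u \<noteq> v" using g *(7) by (auto simp: simple_graph_def)
      then show ?thesis
        using partition_edge_oriented[OF w *(2-7)]
          partition_edge_oriented[OF w'[folded Q] *(2-7)] *(1) by auto
    next
      case False
      have "q \<in> orientations (partition_graph_edges E Q)" "q' \<in> orientations (partition_graph_edges E Q)"
        using w w' Q by (simp_all add: pao_witness_def acyclic_orientation_def)
      note this[unfolded orientations_def, THEN PiE_arb, OF False]
      then show ?thesis by simp
    qed
  qed
  with Q show ?thesis by simp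
qed

lemma pao_witness_canonical:
  assumes "simple_graph V E" "pao_witness V E d Q q"
  shows "pao_partition V E d = Q" "pao_quotient V E d = q"
proof -
  show Q: "pao_partition V E d = Q"
    unfolding pao_partition_def
    using pao_witness_unique[OF assms(1)] assms(2) by (intro the_equality) blast+
  show "pao_quotient V E d = q"
    unfolding pao_quotient_def Q
    using pao_witness_unique[OF assms(1)] assms(2) by (intro the_equality) blast+
qed

end

theory Submission
  imports Defs
begin

text \<open>
  Write \<open>f U = |U| + |E(G[U])|\<close> and let \<open>lam\<close> be the affine function of the coordinate sum that is \<open>0\<close>
  on the simplex and \<open>1\<close> on the graph polytope. Since \<open>f\<close> is supermodular, the join is cut out by
  \<open>lam x \<ge> 0\<close> and \<open>x(U) \<ge> f U * lam x\<close> for all \<open>U\<close>, and a face is determined by the constraints that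
  are tight at its relative interior points. If \<open>lam x = 0\<close>, the tight sets are those avoiding the
  support of \<open>x\<close>. If \<open>lam x > 0\<close>, the defect of modularity of \<open>f\<close> counts crossing edges, so no edge
  crosses two tight sets; orienting each edge towards the end contained in fewer tight sets gives a
  partial acyclic orientation of the union of the tight sets, whose ideals are exactly the tight sets.
  Conversely every partial acyclic orientation is realized by distributing the edge weights according
  to the orientation. The blocks of the orientation give independent equations of the face, which
  yields its dimension.
\<close>

section \<open>Faces of a polyhedron and their tight constraints\<close>

text \<open>Scaling the weights by \<open>lam x\<close> lets one system serve every height. At
  height \<open>0\<close> it collapses to nonnegativity. At positive height the equation for the
  coordinate sum survives only as the constraint of \<open>UNIV\<close>, which is equivalent to
  \<open>lam x \<le> 1\<close>. Hence \<open>UNIV\<close> is usually not tight inside the join, and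
  orientations of induced subgraphs on proper vertex sets occur. Since \<open>N\<close> differs from
  the coordinate sum \<open>M\<close> of the graph polytope, the two polytopes lie in distinct
  parallel hyperplanes; dividing by \<open>M - N\<close> treats both signs of the difference alike.
  The constraint of the empty set is tight everywhere. So the polytope and the removed facet have
  the tight sets \<open>{Some {}}\<close> and \<open>{None, Some {}}\<close>, which would be the
  labels of the orientation of the empty graph and of the subset \<open>UNIV\<close>: exactly the
  two degenerate symbols left out of \<open>ycells\<close>.\<close>

locale halfspace_system =
  fixes a :: "'i::finite \<Rightarrow> 'v::euclidean_space" and b :: "'i \<Rightarrow> real"
begin

definition polyh :: "'v set" where
  "polyh = {x. \<forall>i. b i \<le> a i \<bullet> x}"

definition tight :: "'v \<Rightarrow> 'i set" where
  "tight x = {i. a i \<bullet> x = b i}"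

definition tight_face :: "'i set \<Rightarrow> 'v set" where
  "tight_face Z = {x \<in> polyh. Z \<subseteq> tight x}"

lemma polyhedron_polyh: "polyhedron polyh"
proof -
  have "polyh = (\<Inter>i. {x. a i \<bullet> x \<ge> b i})"
    by (auto simp: polyh_def)
  then show ?thesis
    by (auto intro!: polyhedron_Inter polyhedron_halfspace_ge)
qed

lemma convex_polyh: "convex polyh"
  by (simp add: polyhedron_polyh polyhedron_imp_convex)

lemma tight_face_face_of: "tight_face Z face_of polyh"
proof -
  have "finite Z" by simp
  then show ?thesis
  proof (induction Z rule: finite_induct)
    case empty
    then show ?case by (simp add: tight_face_def convex_polyh face_of_refl)
  next
    case (insert i Z)
    have "tight_face (insert i Z) = tight_face Z \<inter> (polyh \<inter> {x. a i \<bullet> x = b i})"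
      by (auto simp: tight_face_def tight_def)
    moreover have "(polyh \<inter> {x. a i \<bullet> x = b i}) face_of polyh"
      by (intro face_of_Int_supporting_hyperplane_ge convex_polyh) (simp add: polyh_def)
    ultimately show ?case
      using insert.IH by (simp add: face_of_Int)
  qed
qed

text \<open>Near \<open>x\<close> only the equations of the tight constraints are felt. The face
  lies in their affine solution space \<open>S\<close> and contains \<open>S \<inter> O'\<close>,
  where the open set \<open>O'\<close> keeps all other constraints strict; hence its affine hull is
  \<open>S\<close>, a translate of the homogeneous solution space.\<close>

lemma
  assumes x: "x \<in> polyh"
  shows mem_rel_interior_tight_face: "x \<in> rel_interior (tight_face (tight x))"
    and aff_dim_tight_face:
      "aff_dim (tight_face (tight x)) = int (dim {z. \<forall>i\<in>tight x. a i \<bullet> z = 0})"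
proof -
  define S where "S = {y. \<forall>i\<in>tight x. a i \<bullet> y = b i}"
  define L where "L = {z. \<forall>i\<in>tight x. a i \<bullet> z = 0}"
  define O' where "O' = (\<Inter>i\<in>- tight x. {y. b i < a i \<bullet> y})"
  have "open O'"
    unfolding O'_def by (intro open_INT) (auto intro: open_halfspace_gt)
  have xO: "x \<in> S \<inter> O'"
    using x by (auto simp: S_def O'_def polyh_def tight_def order_less_le)
  have "subspace L"
    unfolding L_def by (auto simp: subspace_def inner_add_right)
  have S_L: "S = (+) x ` L"
  proof (intro equalityI subsetI)
    fix y assume "y \<in> S"
    then have "y - x \<in> L"
      by (auto simp: S_def L_def tight_def inner_diff_right)
    then show "y \<in> (+) x ` L"
      by (metis add.commute diff_add_cancel image_eqI)
  qed (auto simp: S_def L_def tight_def inner_add_right)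
  have "affine S"
    using \<open>subspace L\<close> by (simp add: S_L affine_translation[symmetric] subspace_imp_affine)
  have sub: "S \<inter> O' \<subseteq> tight_face (tight x)"
  proof
    fix y assume y: "y \<in> S \<inter> O'"
    have "b i \<le> a i \<bullet> y" for i
      using y by (cases "i \<in> tight x") (auto simp: S_def O'_def order_less_imp_le)
    then show "y \<in> tight_face (tight x)"
      using y by (auto simp: S_def tight_face_def polyh_def tight_def)
  qed
  have sup: "tight_face (tight x) \<subseteq> S"
    by (auto simp: S_def tight_face_def tight_def)
  have hull: "affine hull (tight_face (tight x)) = S"
    using hull_mono[OF sub, of affine] hull_mono[OF sup, of affine] \<open>affine S\<close> \<open>open O'\<close> xO
      affine_hull_affine_Int_open[of S O'] by (metis empty_iff hull_same order_antisym)
  show "x \<in> rel_interior (tight_face (tight x))"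
    unfolding mem_rel_interior hull using \<open>open O'\<close> xO sub by (intro exI[of _ O']) auto
  show "aff_dim (tight_face (tight x)) = int (dim {z. \<forall>i\<in>tight x. a i \<bullet> z = 0})"
    using aff_dim_affine_hull[of "tight_face (tight x)"] \<open>subspace L\<close>
    by (simp add: hull S_L aff_dim_translation_eq aff_dim_subspace flip: L_def)
qed

text \<open>Two faces whose relative interiors meet are equal, so a nonempty face is recovered from
  the tight set of any of its relative interior points.\<close>

lemma nonempty_faces_eq:
  "{F. F face_of polyh \<and> F \<noteq> {}} = tight_face ` tight ` polyh"
proof (intro equalityI subsetI)
  fix F assume F: "F \<in> {F. F face_of polyh \<and> F \<noteq> {}}"
  then obtain x where x: "x \<in> rel_interior F"
    using face_of_imp_convex rel_interior_eq_empty by blast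
  then have "x \<in> polyh"
    using F face_of_imp_subset rel_interior_subset by blast
  then have "F = tight_face (tight x)"
    using face_of_eq[of F polyh "tight_face (tight x)"] F x tight_face_face_of
      mem_rel_interior_tight_face by blast
  then show "F \<in> tight_face ` tight ` polyh"
    using \<open>x \<in> polyh\<close> by blast
next
  fix F assume "F \<in> tight_face ` tight ` polyh"
  then show "F \<in> {F. F face_of polyh \<and> F \<noteq> {}}"
    using tight_face_face_of by (auto simp: tight_face_def)
qed

text \<open>A point whose tight set is exactly \<open>Z\<close> lies in \<open>tight_face Z\<close>,
  so it tests the inclusion.\<close>

lemma tight_face_subset_iff:
  assumes "Z \<in> tight ` polyh"
  shows "tight_face Z \<subseteq> tight_face Z' \<longleftrightarrow> Z' \<subseteq> Z"
  using assms by (auto simp: tight_face_def)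

text \<open>This reduces the theorem to combinatorics: it remains to list the tight sets as labels
  \<open>Z\<close> of the abstract cells, to compare labels by inclusion, which reverses the
  inclusion of faces, and to compute dimensions of homogeneous solution spaces. The hypothesis on
  subsets of \<open>Z1\<close> says that only the whole polytope lies above the facet
  \<open>B\<close>.\<close>

lemma face_complex_realization:
  fixes C :: "'z set" and Z :: "'z \<Rightarrow> 'i set"
  assumes bounded: "bounded polyh"
    and inj: "inj_on Z C"
    and tights: "tight ` polyh = Z ` C \<union> {Z0, Z1}"
    and new: "Z0 \<notin> Z ` C" "Z1 \<notin> Z ` C"
    and top: "tight_face Z0 = polyh" and facet: "tight_face Z1 = B"
    and maximal: "\<And>T. T \<in> tight ` polyh \<Longrightarrow> T \<subseteq> Z1 \<Longrightarrow> T \<in> {Z0, Z1}"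
  defines "Y \<equiv> {F. F face_of polyh \<and> F \<noteq> {} \<and> F \<noteq> polyh \<and> F \<noteq> B}"
  shows "polytopal_complex Y \<and>
    (\<exists>\<phi>. bij_betw \<phi> (open_cells Y) C \<and>
      (\<forall>c\<in>open_cells Y. \<forall>c'\<in>open_cells Y. closure c \<subseteq> closure c' \<longleftrightarrow> Z (\<phi> c') \<subseteq> Z (\<phi> c)) \<and>
      (\<forall>c\<in>open_cells Y. \<exists>x\<in>polyh. tight x = Z (\<phi> c) \<and>
         aff_dim c = int (dim {z. \<forall>i\<in>tight x. a i \<bullet> z = 0})))"
proof -
  have poly: "polytope polyh"
    using bounded polyhedron_polyh by (simp add: polytope_eq_bounded_polyhedron)
  have tf_inj: "inj_on tight_face (tight ` polyh)"
    by (intro inj_onI) (metis tight_face_subset_iff order_antisym order_refl)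
  have Y_eq: "Y = tight_face ` Z ` C"
  proof -
    have "Y = {F. F face_of polyh \<and> F \<noteq> {}} - {polyh, B}"
      unfolding Y_def by blast
    also have "\<dots> = tight_face ` tight ` polyh - tight_face ` {Z0, Z1}"
      using nonempty_faces_eq top facet by simp
    also have "\<dots> = tight_face ` (tight ` polyh - {Z0, Z1})"
      by (rule inj_on_image_set_diff[OF tf_inj, symmetric]) (use tights in auto)
    also have "tight ` polyh - {Z0, Z1} = Z ` C"
      using tights new by blast
    finally show ?thesis .
  qed
  have "finite Y"
    by (rule finite_subset[OF _ finite_polytope_faces[OF poly]]) (auto simp: Y_def)
  have complex: "polytopal_complex Y"
    unfolding polytopal_complex_def
  proof (intro conjI ballI allI impI \<open>finite Y\<close>)
    fix S assume "S \<in> Y"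
    then have S: "S face_of polyh" "S \<noteq> {}" "S \<noteq> polyh" "S \<noteq> B"
      by (auto simp: Y_def)
    show "polytope S" "S \<noteq> {}"
      using S poly face_of_polytope_polytope by auto
    fix F assume F: "F face_of S \<and> F \<noteq> {}"
    have "F face_of polyh" using F S(1) face_of_trans by blast
    moreover have "F \<noteq> polyh"
      using F S face_of_imp_subset by blast
    moreover have "F \<noteq> B"
    proof
      assume "F = B"
      obtain Zs where Zs: "Zs \<in> Z ` C" "S = tight_face Zs"
        using \<open>S \<in> Y\<close> Y_eq by blast
      \<comment> \<open>If the removed facet were a face of \<open>S\<close>, the tight set of
        \<open>S\<close> would lie inside that of the facet, which leaves only the two excluded
        labels.\<close>
      have "Zs \<subseteq> Z1"
        using \<open>F = B\<close> F face_of_imp_subset[of F S] tight_face_subset_iff[of Z1 Zs] Zs tights facet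
        by blast
      then show False using maximal[of Zs] Zs tights new by blast
    qed
    ultimately show "F \<in> Y" using F by (simp add: Y_def)
  next
    fix S T assume "S \<in> Y" "T \<in> Y"
    then have "S face_of polyh" "T face_of polyh" by (auto simp: Y_def)
    then show "S \<inter> T face_of S" "S \<inter> T face_of T"
      using face_of_Int[of S polyh T] face_of_imp_subset
      by (auto intro: face_of_subset)
  qed
  have closure: "closure (rel_interior F) = F" if "F \<in> Y" for F
    using that complex polytope_imp_convex polytope_imp_closed convex_closure_rel_interior
    by (metis closure_closed polytopal_complex_def)
  define \<psi> where "\<psi> z = rel_interior (tight_face (Z z))" for z
  have \<psi>_inj: "inj_on \<psi> C"
  proof (rule inj_onI)
    fix z z' assume z: "z \<in> C" "z' \<in> C" "\<psi> z = \<psi> z'"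
    then have "tight_face (Z z) = tight_face (Z z')"
      using closure Y_eq unfolding \<psi>_def by (metis imageI)
    then show "z = z'"
      using tf_inj inj z tights unfolding inj_on_def by (metis UnI1 imageI)
  qed
  have cells: "open_cells Y = \<psi> ` C"
    by (auto simp: open_cells_def Y_eq \<psi>_def)
  define \<phi> where "\<phi> = inv_into C \<psi>"
  have \<phi>: "\<phi> (\<psi> z) = z" if "z \<in> C" for z
    using \<psi>_inj that by (simp add: \<phi>_def)
  have "bij_betw \<phi> (open_cells Y) C"
    unfolding cells \<phi>_def by (rule bij_betw_inv_into[OF inj_on_imp_bij_betw[OF \<psi>_inj]])
  moreover have "closure c \<subseteq> closure c' \<longleftrightarrow> Z (\<phi> c') \<subseteq> Z (\<phi> c)"
    if c: "c \<in> open_cells Y" "c' \<in> open_cells Y" for c c'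
  proof -
    obtain z where z: "z \<in> C" "c = \<psi> z" using c(1) cells by auto
    obtain z' where z': "z' \<in> C" "c' = \<psi> z'" using c(2) cells by auto
    have "closure c = tight_face (Z z)"
      unfolding z(2) \<psi>_def by (rule closure) (use z(1) Y_eq in simp)
    moreover have "closure c' = tight_face (Z z')"
      unfolding z'(2) \<psi>_def by (rule closure) (use z'(1) Y_eq in simp)
    moreover have "Z z \<in> tight ` polyh" using tights z(1) by simp
    ultimately show ?thesis
      using \<phi>[OF z(1)] \<phi>[OF z'(1)] z(2) z'(2) by (simp add: tight_face_subset_iff)
  qed
  moreover have "\<exists>x\<in>polyh. tight x = Z (\<phi> c) \<and>
         aff_dim c = int (dim {z. \<forall>i\<in>tight x. a i \<bullet> z = 0})" if c: "c \<in> open_cells Y" for c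
  proof -
    obtain z where z: "z \<in> C" "c = \<psi> z" using c cells by auto
    then have "Z z \<in> tight ` polyh" using tights by simp
    then obtain x where x: "x \<in> polyh" "tight x = Z z" by auto
    have "aff_dim c = aff_dim (tight_face (Z z))"
      unfolding z(2) \<psi>_def
      by (rule rel_interior_aff_dim[OF face_of_imp_convex[OF tight_face_face_of]])
    then show ?thesis
      using aff_dim_tight_face[OF x(1)] x z(2) \<phi>[OF z(1)] by (intro bexI[of _ x]) auto
  qed
  ultimately show ?thesis using complex by (intro conjI exI[of _ \<phi>] ballI)
qed

end

text \<open>Indicator vectors of disjoint nonempty sets are nonzero and pairwise orthogonal, hence
  independent, and the space in question is their orthogonal complement. All cell dimensions are
  read off from this count.\<close>

lemma dim_orthogonal_to_disjoint_indicators: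
  fixes Q :: "'n::finite set set"
  assumes Q: "disjoint Q" "{} \<notin> Q"
  shows "dim {w :: real^'n. \<forall>B\<in>Q. (\<Sum>i\<in>B. w $ i) = 0} + card Q = CARD('n)"
proof -
  define ind :: "'n set \<Rightarrow> real^'n" where "ind B = (\<chi> i. if i \<in> B then 1 else 0)" for B
  have ind: "ind B \<bullet> w = (\<Sum>i\<in>B. w $ i)" for B w
    by (simp add: ind_def inner_vec_def if_distrib[of "\<lambda>c. c * _"] sum.If_cases cong: if_cong)
  have inj: "inj ind"
    by (auto simp: inj_def ind_def vec_eq_iff split: if_splits)
  have "independent (ind ` Q)"
  proof (rule pairwise_orthogonal_independent)
    show "pairwise orthogonal (ind ` Q)"
      unfolding pairwise_image
    proof (rule pairwiseI, rule impI)
      fix A B assume "A \<in> Q" "B \<in> Q" "ind A \<noteq> ind B"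
      then have "A \<inter> B = {}" using Q unfolding disjoint_def by metis
      then show "orthogonal (ind A) (ind B)"
        unfolding orthogonal_def ind by (auto simp: ind_def intro!: sum.neutral)
    qed
    show "0 \<notin> ind ` Q"
      using Q by (auto simp: ind_def vec_eq_iff) (metis equals0I zero_neq_one)
  qed
  then have card: "dim (span (ind ` Q)) = card Q"
    using inj by (simp add: dim_eq_card_independent card_image inj_on_subset)
  have "{w :: real^'n. \<forall>B\<in>Q. (\<Sum>i\<in>B. w $ i) = 0} = {y \<in> UNIV. \<forall>x\<in>span (ind ` Q). orthogonal x y}"
  proof (intro equalityI subsetI)
    fix w :: "real^'n" assume w: "w \<in> {w. \<forall>B\<in>Q. (\<Sum>i\<in>B. w $ i) = 0}"
    then have "orthogonal w x" if "x \<in> span (ind ` Q)" for x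
      using that by (intro orthogonal_to_span[of x "ind ` Q" w])
        (auto simp: orthogonal_def ind inner_commute[of w])
    then show "w \<in> {y \<in> UNIV. \<forall>x\<in>span (ind ` Q). orthogonal x y}"
      using orthogonal_commute by blast
  next
    fix w assume w: "w \<in> {y \<in> UNIV. \<forall>x\<in>span (ind ` Q). orthogonal x y}"
    then have "ind B \<bullet> w = 0" if "B \<in> Q" for B
      using that span_base[of "ind B" "ind ` Q"] by (auto simp: orthogonal_def)
    then show "w \<in> {w. \<forall>B\<in>Q. (\<Sum>i\<in>B. w $ i) = 0}"
      by (simp add: ind)
  qed
  then show ?thesis
    using dim_subspace_orthogonal_to_vectors[of "span (ind ` Q)" UNIV] card by simp
qed

section \<open>Ideals of partial acyclic orientations\<close>

text \<open>An undirected edge yields arcs both ways. For a partial acyclic orientation the blocks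
  are then the strongly connected components of this relation, so order ideals of the quotient can
  be handled as sets of vertices.\<close>

definition weak_arcs :: "'a set set \<Rightarrow> 'a orientation \<Rightarrow> ('a \<times> 'a) set" where
  "weak_arcs E d = {(u, v). {u, v} \<in> E \<and> (d {u, v} = None \<or> d {u, v} = Some (u, v))}"

definition pred_closed :: "'a set \<Rightarrow> 'a set set \<Rightarrow> 'a orientation \<Rightarrow> 'a set \<Rightarrow> bool" where
  "pred_closed V E d W \<longleftrightarrow> W \<subseteq> V \<and> (\<forall>(u, v)\<in>weak_arcs E d. v \<in> W \<longrightarrow> u \<in> W)"

lemma pred_closed_rtrancl:
  assumes "pred_closed V E d W" "(u, v) \<in> (weak_arcs E d)\<^sup>*" "v \<in> W"
  shows "u \<in> W"
  using assms(2,3)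
proof (induction rule: converse_rtrancl_induct)
  case (step y z)
  then show ?case using assms(1) by (auto simp: pred_closed_def)
qed

context
  fixes V :: "'a set" and E :: "'a set set" and d :: "'a orientation" and Q q
  assumes g: "simple_graph V E" and w: "pao_witness V E d Q q"
begin

lemma pao_witness_partition: "partition_on V Q"
  using w by (simp add: pao_witness_def connected_partition_def)

lemma pao_witness_arc:
  assumes "(\<sigma>, \<rho>) \<in> arcs (partition_graph_edges E Q) q"
  shows "\<sigma> \<in> Q \<and> \<rho> \<in> Q \<and> \<sigma> \<noteq> \<rho> \<and> (\<exists>u\<in>\<sigma>. \<exists>v\<in>\<rho>. {u, v} \<in> E \<and> d {u, v} = Some (u, v))"
proof -
  obtain e where e: "e \<in> partition_graph_edges E Q" "q e = Some (\<sigma>, \<rho>)"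
    using assms by (auto simp: arcs_def)
  have "q \<in> orientations (partition_graph_edges E Q)"
    using w by (simp add: pao_witness_def acyclic_orientation_def)
  then have "q e \<in> insert None {Some (u, v) | u v. e = {u, v}}"
    using PiE_mem[OF _ e(1)] unfolding orientations_def by blast
  then have e': "e = {\<sigma>, \<rho>}" using e(2) by auto
  then obtain \<sigma>' \<rho>' u v where *: "{\<sigma>, \<rho>} = {\<sigma>', \<rho>'}" "\<sigma>' \<in> Q" "\<rho>' \<in> Q" "\<sigma>' \<noteq> \<rho>'"
      "u \<in> \<sigma>'" "v \<in> \<rho>'" "{u, v} \<in> E"
    using e(1) unfolding partition_graph_edges_def by blast
  then obtain u v where **: "\<sigma> \<in> Q" "\<rho> \<in> Q" "\<sigma> \<noteq> \<rho>" "u \<in> \<sigma>" "v \<in> \<rho>" "{u, v} \<in> E"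
    by (metis doubleton_eq_iff insert_commute)
  then have "d {u, v} = Some (u, v)"
    using partition_edge_oriented[OF w **] e(2) e' by auto
  then show ?thesis using ** by blast
qed

lemma block_subset_pred_closed:
  assumes "pred_closed V E d W" "\<sigma> \<in> Q" "u \<in> \<sigma>" "u \<in> W"
  shows "\<sigma> \<subseteq> W"
proof
  fix v assume v: "v \<in> \<sigma>"
  have "(v, u) \<in> {(a, b). {a, b} \<in> E \<and> d {a, b} = None}\<^sup>*"
    using pao_witness_block[OF g w assms(2) v] assms(3) by blast
  also have "\<dots> \<subseteq> (weak_arcs E d)\<^sup>*"
    by (rule rtrancl_mono) (auto simp: weak_arcs_def)
  finally show "v \<in> W" using pred_closed_rtrancl assms by metis
qed

text \<open>A weak path projects to the partition graph: arcs inside a block collapse, and every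
  other arc follows the quotient orientation.\<close>

lemma weak_arc_blocks:
  assumes "(u, v) \<in> (weak_arcs E d)\<^sup>*" "\<sigma> \<in> Q" "\<rho> \<in> Q" "u \<in> \<sigma>" "v \<in> \<rho>"
  shows "(\<sigma>, \<rho>) \<in> (arcs (partition_graph_edges E Q) q)\<^sup>*"
  using assms(1,3,5)
proof (induction arbitrary: \<rho> rule: rtrancl_induct)
  case base
  then show ?case
    using assms(2,4) pao_witness_partition disjointD[of Q \<sigma> \<rho>] by (auto simp: partition_on_def)
next
  case (step x v)
  then have xv: "{x, v} \<in> E" "d {x, v} = None \<or> d {x, v} = Some (x, v)"
    by (auto simp: weak_arcs_def)
  then have "x \<in> V" "x \<noteq> v" using g by (auto simp: simple_graph_def)
  then obtain \<mu> where \<mu>: "\<mu> \<in> Q" "x \<in> \<mu>"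
    using pao_witness_partition by (auto simp: partition_on_def)
  have "(\<mu>, \<rho>) \<in> (arcs (partition_graph_edges E Q) q)\<^sup>*"
  proof (cases "\<mu> = \<rho>")
    case False
    then have "q {\<mu>, \<rho>} = Some (\<mu>, \<rho>)"
      using partition_edge_oriented[OF w \<mu>(1) step.prems(1) False \<mu>(2) step.prems(2) xv(1)] xv(2)
        \<open>x \<noteq> v\<close> by auto
    moreover have "{\<mu>, \<rho>} \<in> partition_graph_edges E Q"
      using \<mu> step.prems xv(1) False unfolding partition_graph_edges_def by blast
    ultimately show ?thesis by (auto simp: arcs_def)
  qed simp
  then show ?case using step.IH[OF \<mu>] by (meson rtrancl_trans)
qed

lemma weak_arcs_antisym:
  assumes "(u, v) \<in> (weak_arcs E d)\<^sup>*" "(v, u) \<in> (weak_arcs E d)\<^sup>*" "\<sigma> \<in> Q" "u \<in> \<sigma>" "v \<in> V"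
  shows "v \<in> \<sigma>"
proof -
  obtain \<rho> where \<rho>: "\<rho> \<in> Q" "v \<in> \<rho>"
    using assms(5) pao_witness_partition by (auto simp: partition_on_def)
  have "acyclic (arcs (partition_graph_edges E Q) q)"
    using w by (simp add: pao_witness_def acyclic_orientation_def)
  then have "\<sigma> = \<rho>"
    using weak_arc_blocks[OF assms(1,3) \<rho>(1) assms(4) \<rho>(2)]
      weak_arc_blocks[OF assms(2) \<rho>(1) assms(3) \<rho>(2) assms(4)]
    by (meson acyclic_impl_antisym_rtrancl antisymD)
  then show ?thesis using \<rho> by simp
qed

lemma principal_pred_closed:
  assumes "p \<in> V"
  shows "pred_closed V E d {u. (u, p) \<in> (weak_arcs E d)\<^sup>*}"
proof -
  have "u \<in> V" if "(u, p) \<in> (weak_arcs E d)\<^sup>*" for u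
    using that assms g by (cases rule: converse_rtranclE) (auto simp: weak_arcs_def simple_graph_def)
  then show ?thesis
    by (auto simp: pred_closed_def intro: converse_rtrancl_into_rtrancl)
qed

lemma pao_ideals_witness: "pao_ideals V E d = {W. pred_closed V E d W}"
proof -
  let ?A = "arcs (partition_graph_edges E Q) q"
  have ideal: "pao_ideals V E d = {\<Union> I | I. order_ideal Q (partition_graph_edges E Q) q I}"
    by (simp add: pao_ideals_def pao_witness_canonical[OF g w])
  show ?thesis
    unfolding ideal
  proof (intro equalityI subsetI)
    fix W assume "W \<in> {\<Union> I | I. order_ideal Q (partition_graph_edges E Q) q I}"
    then obtain I where I: "W = \<Union> I" "I \<subseteq> Q"
        "\<And>a b. a \<in> Q \<Longrightarrow> b \<in> I \<Longrightarrow> (a, b) \<in> ?A\<^sup>* \<Longrightarrow> a \<in> I"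
      by (auto simp: order_ideal_def)
    have "W \<subseteq> V" using I pao_witness_partition by (auto simp: partition_on_def)
    moreover have "u \<in> W" if uv: "(u, v) \<in> weak_arcs E d" "v \<in> W" for u v
    proof -
      obtain \<rho> where \<rho>: "\<rho> \<in> I" "v \<in> \<rho>" using uv(2) I by blast
      have "u \<in> V" using uv g by (auto simp: weak_arcs_def simple_graph_def)
      then obtain \<sigma> where \<sigma>: "\<sigma> \<in> Q" "u \<in> \<sigma>"
        using pao_witness_partition by (auto simp: partition_on_def)
      have "\<sigma> \<in> I"
        using weak_arc_blocks[of u v \<sigma> \<rho>] uv \<sigma> \<rho> I(2) I(3)[OF \<sigma>(1) \<rho>(1)] by blast
      then show ?thesis using \<sigma> I by blast
    qed
    ultimately show "W \<in> {W. pred_closed V E d W}" by (auto simp: pred_closed_def)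
  next
    fix W assume "W \<in> {W. pred_closed V E d W}"
    then have W: "pred_closed V E d W" by simp
    define I where "I = {\<sigma> \<in> Q. \<sigma> \<subseteq> W}"
    have "W = \<Union> I"
    proof
      show "W \<subseteq> \<Union> I"
      proof
        fix u assume u: "u \<in> W"
        then obtain \<sigma> where "\<sigma> \<in> Q" "u \<in> \<sigma>"
          using W pao_witness_partition by (auto simp: partition_on_def pred_closed_def)
        then show "u \<in> \<Union> I" using block_subset_pred_closed[OF W] u by (auto simp: I_def)
      qed
    qed (auto simp: I_def)
    moreover have down: "a \<in> I" if "b \<in> I" "(a, b) \<in> ?A\<^sup>*" for a b
      using that(2,1)
    proof (induction rule: converse_rtrancl_induct)
      case (step y z)
      obtain u v where uv: "u \<in> y" "v \<in> z" "{u, v} \<in> E" "d {u, v} = Some (u, v)" "y \<in> Q"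
        using pao_witness_arc[OF step.hyps(1)] by blast
      then have "u \<in> W"
        using step.IH step.prems W unfolding I_def pred_closed_def weak_arcs_def by blast
      then show ?case
        using block_subset_pred_closed[OF W \<open>y \<in> Q\<close> uv(1)] uv by (simp add: I_def)
    qed
    have "order_ideal Q (partition_graph_edges E Q) q I"
      unfolding order_ideal_def using down by (metis (no_types, lifting) I_def mem_Collect_eq subsetI)
    ultimately show "W \<in> {\<Union> I | I. order_ideal Q (partition_graph_edges E Q) q I}"
      by (intro CollectI exI[of _ I]) simp
  qed
qed

text \<open>Take the principal ideal \<open>U\<close> of a vertex of the block and remove the block.
  The rest is still closed: an arc from the block to a remaining vertex would make that vertex
  mutually reachable with the block, against acyclicity. Thus equations indexed by ideals yield
  equations indexed by blocks.\<close>

lemma block_eq_ideal_difference: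
  assumes \<sigma>: "\<sigma> \<in> Q"
  shows "\<exists>U U'. pred_closed V E d U \<and> pred_closed V E d U' \<and> U' \<subseteq> U \<and> U - U' = \<sigma>"
proof -
  obtain p where p: "p \<in> \<sigma>" using \<sigma> pao_witness_partition by (metis partition_onD3 ex_in_conv)
  then have pV: "p \<in> V" using \<sigma> pao_witness_partition by (auto simp: partition_on_def)
  define U where "U = {u. (u, p) \<in> (weak_arcs E d)\<^sup>*}"
  have U: "pred_closed V E d U" unfolding U_def by (rule principal_pred_closed[OF pV])
  have "p \<in> U" by (simp add: U_def)
  have sub: "\<sigma> \<subseteq> U" using block_subset_pred_closed[OF U \<sigma> p \<open>p \<in> U\<close>] .
  have "pred_closed V E d (U - \<sigma>)"
    unfolding pred_closed_def
  proof (intro conjI ballI, goal_cases)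
    case 1
    then show ?case using U by (auto simp: pred_closed_def)
  next
    case (2 e)
    obtain u v where e: "e = (u, v)" by (cases e)
    have "u \<in> U - \<sigma>" if v: "v \<in> U" "v \<notin> \<sigma>"
    proof -
      have uv: "(u, v) \<in> weak_arcs E d" using 2 e by simp
      then have "u \<in> U" using U v by (auto simp: pred_closed_def)
      moreover have "u \<notin> \<sigma>"
      proof
        assume u: "u \<in> \<sigma>"
        have "{(a, b). {a, b} \<in> E \<and> d {a, b} = None}\<^sup>* \<subseteq> (weak_arcs E d)\<^sup>*"
          by (rule rtrancl_mono) (auto simp: weak_arcs_def)
        moreover have "(p, u) \<in> {(a, b). {a, b} \<in> E \<and> d {a, b} = None}\<^sup>*"
          using pao_witness_block[OF g w \<sigma> p] u by blast
        ultimately have "(p, v) \<in> (weak_arcs E d)\<^sup>*"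
          using uv by (meson rtrancl.rtrancl_into_rtrancl subsetD)
        moreover have "(v, p) \<in> (weak_arcs E d)\<^sup>*" "v \<in> V"
          using v U by (auto simp: U_def pred_closed_def)
        ultimately show False using weak_arcs_antisym \<sigma> p v by metis
      qed
      ultimately show ?thesis by simp
    qed
    then show ?case using e by simp
  qed
  moreover have "U - (U - \<sigma>) = \<sigma>" using sub by blast
  ultimately show ?thesis using U by blast
qed

text \<open>If the edge is directed from \<open>u\<close> to \<open>v\<close>, the principal ideal
  of \<open>u\<close> misses \<open>v\<close> by acyclicity. If it is undirected or reversed, the
  weak arc from \<open>v\<close> to \<open>u\<close> forbids such a set. So the orientation can be
  read off from its ideals, which makes labels injective.\<close>

lemma arc_iff_separated:
  assumes uv: "{u, v} \<in> E"
  shows "d {u, v} = Some (u, v) \<longleftrightarrow> (\<exists>W. pred_closed V E d W \<and> u \<in> W \<and> v \<notin> W)"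
proof
  assume d: "d {u, v} = Some (u, v)"
  have uV: "u \<in> V" "v \<in> V" "u \<noteq> v" using uv g by (auto simp: simple_graph_def)
  let ?W = "{x. (x, u) \<in> (weak_arcs E d)\<^sup>*}"
  obtain \<sigma> where \<sigma>: "\<sigma> \<in> Q" "u \<in> \<sigma>"
    using uV(1) pao_witness_partition by (auto simp: partition_on_def)
  have "v \<notin> ?W"
  proof
    assume "v \<in> ?W"
    moreover have "(u, v) \<in> (weak_arcs E d)\<^sup>*"
      using uv d by (auto simp: weak_arcs_def)
    ultimately have "v \<in> \<sigma>" using weak_arcs_antisym \<sigma> uV by blast
    then have "d {u, v} = None"
      using w \<sigma> uv by (auto simp: pao_witness_def)
    then show False using d by simp
  qed
  then show "\<exists>W. pred_closed V E d W \<and> u \<in> W \<and> v \<notin> W"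
    using principal_pred_closed[OF uV(1)] by blast
next
  assume "\<exists>W. pred_closed V E d W \<and> u \<in> W \<and> v \<notin> W"
  then have "(v, u) \<notin> weak_arcs E d"
    by (auto simp: pred_closed_def)
  then have "d {u, v} \<noteq> None" "d {u, v} \<noteq> Some (v, u)"
    using uv by (auto simp: weak_arcs_def insert_commute)
  moreover have "d \<in> (\<Pi>\<^sub>E e\<in>E. insert None {Some (a, b) | a b. e = {a, b}})"
    using w by (simp add: pao_witness_def orientations_def)
  note PiE_mem[OF this uv]
  ultimately show "d {u, v} = Some (u, v)" by (auto simp: doubleton_eq_iff)
qed

end

lemma pao_ideals_eq:
  assumes "simple_graph V E" "pao V E d"
  shows "pao_ideals V E d = {W. pred_closed V E d W}"
  using assms pao_ideals_witness unfolding pao_def by blast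

lemma pao_partition_partition_on:
  assumes "simple_graph V E" "pao V E d"
  shows "partition_on V (pao_partition V E d)"
  using assms pao_witness_partition pao_witness_canonical(1) unfolding pao_def by metis

lemma pao_partition_ideals:
  assumes "simple_graph V E" "pao V E d"
  shows "U \<in> pao_ideals V E d \<Longrightarrow> \<exists>I\<subseteq>pao_partition V E d. U = \<Union> I"
    and "B \<in> pao_partition V E d \<Longrightarrow>
      \<exists>U\<in>pao_ideals V E d. \<exists>U'\<in>pao_ideals V E d. U' \<subseteq> U \<and> U - U' = B"
proof -
  show "\<exists>I\<subseteq>pao_partition V E d. U = \<Union> I" if "U \<in> pao_ideals V E d"
    using that by (auto simp: pao_ideals_def order_ideal_def Let_def)
  show "\<exists>U\<in>pao_ideals V E d. \<exists>U'\<in>pao_ideals V E d. U' \<subseteq> U \<and> U - U' = B"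
    if "B \<in> pao_partition V E d"
  proof -
    obtain Q q where w: "pao_witness V E d Q q" using assms(2) by (auto simp: pao_def)
    then have "B \<in> Q" using that pao_witness_canonical[OF assms(1)] by simp
    then obtain U U' where "pred_closed V E d U" "pred_closed V E d U'" "U' \<subseteq> U" "U - U' = B"
      using block_eq_ideal_difference[OF assms(1) w] by metis
    then show ?thesis
      unfolding pao_ideals_eq[OF assms] by auto
  qed
qed

lemma whole_mem_pao_ideals:
  assumes "simple_graph V E" "pao V E d"
  shows "V \<in> pao_ideals V E d"
  unfolding pao_ideals_eq[OF assms] using assms(1)
  by (auto simp: pred_closed_def weak_arcs_def simple_graph_def)

lemma pao_eq_if_ideals_eq:
  assumes g: "simple_graph V E" and d: "pao V E d" "pao V E d'"
    and eq: "pao_ideals V E d = pao_ideals V E d'"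
  shows "d = d'"
proof
  fix e
  obtain Q q Q' q' where w: "pao_witness V E d Q q" "pao_witness V E d' Q' q'"
    using d by (auto simp: pao_def)
  have or: "d \<in> orientations E" "d' \<in> orientations E"
    using w by (auto simp: pao_witness_def)
  have iff: "d {u, v} = Some (u, v) \<longleftrightarrow> d' {u, v} = Some (u, v)" if "{u, v} \<in> E" for u v
    using arc_iff_separated[OF g w(1) that] arc_iff_separated[OF g w(2) that] eq
      pao_ideals_eq[OF g d(1)] pao_ideals_eq[OF g d(2)] by auto
  show "d e = d' e"
  proof (cases "e \<in> E")
    case True
    then have *: "d e \<in> insert None {Some (u, v) | u v. e = {u, v}}"
        "d' e \<in> insert None {Some (u, v) | u v. e = {u, v}}"
      using or PiE_mem[OF _ True] unfolding orientations_def by blast+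
    show ?thesis
    proof (cases "d e")
      case None
      then have "d' e \<noteq> Some (u, v)" if "e = {u, v}" for u v
        using iff[of u v] True that None by simp
      then have "d' e = None" using *(2) by blast
      then show ?thesis using None by simp
    next
      case (Some p)
      then have "\<exists>u v. d e = Some (u, v) \<and> e = {u, v}" using *(1) by simp
      then obtain u v where uv: "d e = Some (u, v)" "e = {u, v}" by (elim exE conjE)
      have "d' e = Some (u, v)" using iff[of u v] True uv(1) unfolding uv(2) by simp
      then show ?thesis using uv(1) by simp
    qed
  next
    case False
    then show ?thesis
      using or[unfolded orientations_def, THEN PiE_arb, OF False] by simp
  qed
qed

section \<open>Orientations induced by heights\<close>

text \<open>Arcs point from greater to smaller height. Heights live in a partial order because the
  main instance takes families of tight sets ordered by inclusion.\<close>

definition height_orientation :: "('a \<Rightarrow> 'b::order) \<Rightarrow> 'a set set \<Rightarrow> 'a orientation" where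
  "height_orientation h E = (\<lambda>e\<in>E. if \<exists>u v. e = {u, v} \<and> h v < h u
     then Some (THE (u, v). e = {u, v} \<and> h v < h u) else None)"

lemma height_orientation_Some:
  assumes "{u, v} \<in> E" "h v < h u"
  shows "height_orientation h E {u, v} = Some (u, v)"
proof -
  have "(THE (a, b). {u, v} = {a, b} \<and> h b < h a) = (u, v)"
    using assms(2) by (intro the_equality) (auto simp: doubleton_eq_iff)
  then show ?thesis using assms by (auto simp: height_orientation_def)
qed

lemma height_orientation_None:
  assumes "{u, v} \<in> E" "\<not> h v < h u" "\<not> h u < h v"
  shows "height_orientation h E {u, v} = None"
  using assms by (auto simp: height_orientation_def doubleton_eq_iff)

lemma height_orientation_cases:
  assumes "e \<in> E"
  shows "height_orientation h E e = None \<or>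
    (\<exists>u v. e = {u, v} \<and> h v < h u \<and> height_orientation h E e = Some (u, v))"
proof (cases "\<exists>u v. e = {u, v} \<and> h v < h u")
  case True
  then show ?thesis using height_orientation_Some assms by metis
next
  case False
  then have "height_orientation h E e = None"
    unfolding height_orientation_def using assms by (simp only: restrict_apply if_False if_True)
  then show ?thesis ..
qed

lemma height_orientation_mem: "height_orientation h E \<in> orientations E"
  unfolding orientations_def
proof (rule PiE_I)
  show "height_orientation h E e \<in> insert None {Some (u, v) |u v. e = {u, v}}" if "e \<in> E" for e
    using height_orientation_cases[OF that, of h] by blast
qed (simp add: height_orientation_def)

lemma acyclic_height_orientation: "acyclic (arcs E (height_orientation h E))"
proof -
  have arc: "h v < h u" if "(u, v) \<in> arcs E (height_orientation h E)" for u v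
  proof -
    obtain e where e: "e \<in> E" "height_orientation h E e = Some (u, v)"
      using \<open>(u, v) \<in> arcs E (height_orientation h E)\<close> by (auto simp: arcs_def)
    then show ?thesis using height_orientation_cases[OF e(1), of h] by auto
  qed
  have "h v < h u" if "(u, v) \<in> (arcs E (height_orientation h E))\<^sup>+" for u v
    using that by induction (use arc in \<open>auto intro: order.strict_trans\<close>)
  then show ?thesis unfolding acyclic_def by blast
qed

text \<open>Level sets of \<open>h\<close> may be disconnected, so the blocks are the components of
  the graph of edges between equal heights. Adjacent blocks have distinct comparable heights, so the
  quotient is completely oriented, and descending heights exclude cycles.\<close>

lemma pao_height_orientation:
  fixes h :: "'a \<Rightarrow> 'b::order"
  assumes g: "simple_graph V E"
    and comparable: "\<And>u v. {u, v} \<in> E \<Longrightarrow> h u \<le> h v \<or> h v \<le> h u"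
  shows "pao V E (height_orientation h E)"
    and "weak_arcs E (height_orientation h E) = {(u, v). {u, v} \<in> E \<and> h v \<le> h u}"
proof -
  let ?d = "height_orientation h E"
  have edge: "u \<in> V" "v \<in> V" "u \<noteq> v" if "{u, v} \<in> E" for u v
    using g that by (auto simp: simple_graph_def)
  define S where "S = {(u, v). {u, v} \<in> E \<and> h u = h v}"
  define r where "r = {(u, v). u \<in> V \<and> v \<in> V \<and> (u, v) \<in> S\<^sup>*}"
  define Q where "Q = V // r"
  have "sym S" by (auto simp: S_def sym_def insert_commute)
  then have symS: "(v, u) \<in> S\<^sup>*" if "(u, v) \<in> S\<^sup>*" for u v
    using that by (meson sym_rtrancl symD)
  have "equiv V r"
    by (auto simp: equiv_def refl_on_def sym_def trans_def r_def intro: symS)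
  then have part: "partition_on V Q"
    unfolding Q_def by (rule partition_on_quotient)
  have Q_eq: "\<sigma> = {v. (u, v) \<in> S\<^sup>*}" "u \<in> V" if "\<sigma> \<in> Q" "u \<in> \<sigma>" for \<sigma> u
  proof -
    show "u \<in> V" using part that by (auto simp: partition_on_def)
    have V: "v \<in> V" if "(u, v) \<in> S\<^sup>*" for v
      using that \<open>u \<in> V\<close> by (cases rule: rtranclE) (auto simp: S_def edge)
    have "\<sigma> = r `` {u}"
      using that \<open>equiv V r\<close> unfolding Q_def by (metis Image_singleton_iff equiv_class_eq_iff quotientE)
    then show "\<sigma> = {v. (u, v) \<in> S\<^sup>*}" using V \<open>u \<in> V\<close> by (auto simp: r_def)
  qed
  have h_S: "h u = h v" if "(u, v) \<in> S\<^sup>*" for u v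
    using that by induction (auto simp: S_def)
  \<comment> \<open>The choice of representative is harmless because \<open>h\<close> is constant on
    each block.\<close>
  define H where "H \<sigma> = h (SOME v. v \<in> \<sigma>)" for \<sigma>
  have H: "H \<sigma> = h u" if "\<sigma> \<in> Q" "u \<in> \<sigma>" for \<sigma> u
  proof -
    have "(SOME v. v \<in> \<sigma>) \<in> \<sigma>" using that(2) by (rule someI)
    then have "(u, SOME v. v \<in> \<sigma>) \<in> S\<^sup>*" using Q_eq(1)[OF that] by blast
    then show ?thesis unfolding H_def by (rule h_S[symmetric])
  qed
  have conn: "connected_graph \<sigma> (induced_edges E \<sigma>)" if \<sigma>: "\<sigma> \<in> Q" for \<sigma>
    unfolding connected_graph_def
  proof (intro conjI ballI)
    show "\<sigma> \<noteq> {}" using part \<sigma> by (auto simp: partition_on_def)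
    fix u v assume u: "u \<in> \<sigma>" and v: "v \<in> \<sigma>"
    have "(u, v) \<in> S\<^sup>*" using Q_eq(1)[OF \<sigma> u] v by simp
    then show "(u, v) \<in> {(a, b). {a, b} \<in> induced_edges E \<sigma>}\<^sup>*"
    proof induction
      case (step x y)
      then have "x \<in> \<sigma>" "y \<in> \<sigma>"
        unfolding Q_eq(1)[OF \<sigma> u] by auto
      then have "(x, y) \<in> {(a, b). {a, b} \<in> induced_edges E \<sigma>}"
        using step.hyps(2) by (auto simp: S_def induced_edges_def)
      then show ?case using step.IH by (rule rtrancl_into_rtrancl[rotated])
    qed simp
  qed
  let ?q = "height_orientation H (partition_graph_edges E Q)"
  have cross: "h u \<noteq> h v" if "\<sigma> \<in> Q" "\<rho> \<in> Q" "\<sigma> \<noteq> \<rho>" "u \<in> \<sigma>" "v \<in> \<rho>" "{u, v} \<in> E" for \<sigma> \<rho> u v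
  proof
    assume "h u = h v"
    then have "(u, v) \<in> S\<^sup>*" using that by (auto simp: S_def)
    then have "v \<in> \<sigma>" using Q_eq(1)[OF that(1,4)] by simp
    then show False using that part by (auto simp: partition_on_def disjoint_def)
  qed
  have "pao_witness V E ?d Q ?q"
    unfolding pao_witness_def
  proof (intro conjI ballI impI)
    show "?d \<in> orientations E" by (rule height_orientation_mem)
    show "connected_partition V E Q"
      using part conn by (simp add: connected_partition_def)
    have "?q e \<noteq> None" if e: "e \<in> partition_graph_edges E Q" for e
    proof -
      obtain \<sigma> \<rho> u v where *: "e = {\<sigma>, \<rho>}" "\<sigma> \<in> Q" "\<rho> \<in> Q" "\<sigma> \<noteq> \<rho>" "u \<in> \<sigma>" "v \<in> \<rho>" "{u, v} \<in> E"
        using e unfolding partition_graph_edges_def by blast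
      have "H \<sigma> < H \<rho> \<or> H \<rho> < H \<sigma>"
        using H[OF *(2,5)] H[OF *(3,6)] cross[OF *(2-7)] comparable[OF *(7)]
        by (auto simp: order_less_le)
      then show ?thesis
        using height_orientation_Some[of \<sigma> \<rho> "partition_graph_edges E Q" H]
          height_orientation_Some[of \<rho> \<sigma> "partition_graph_edges E Q" H] e *(1)
        by (auto simp: insert_commute)
    qed
    then show "acyclic_orientation (partition_graph_edges E Q) ?q"
      unfolding acyclic_orientation_def
      using height_orientation_mem acyclic_height_orientation by blast
  next
    fix \<sigma> e assume \<sigma>: "\<sigma> \<in> Q" and e: "e \<in> E" "e \<subseteq> \<sigma>"
    obtain u v where uv: "e = {u, v}"
      using g e by (metis card_2_iff simple_graph_def)
    then have "h u = h v" using H[OF \<sigma>] e by (metis insert_subset)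
    then show "?d e = None" using height_orientation_None[of u v E h] e uv by simp
  next
    fix \<sigma> \<rho> u v
    assume *: "\<sigma> \<in> Q" "\<rho> \<in> Q" "u \<in> \<sigma>" "v \<in> \<rho>"
      and q: "\<sigma> \<noteq> \<rho> \<and> {u, v} \<in> E \<and> ?q {\<sigma>, \<rho>} = Some (\<sigma>, \<rho>)"
    have "{\<sigma>, \<rho>} \<in> partition_graph_edges E Q"
      using * q unfolding partition_graph_edges_def by blast
    then have "H \<rho> < H \<sigma>"
      using height_orientation_cases[of "{\<sigma>, \<rho>}" "partition_graph_edges E Q" H] q by auto
    then have "h v < h u" using H * by metis
    then show "?d {u, v} = Some (u, v)" using height_orientation_Some q by metis
  qed
  then show "pao V E ?d" unfolding pao_def by blast
  show "weak_arcs E ?d = {(u, v). {u, v} \<in> E \<and> h v \<le> h u}"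
  proof -
    have "(?d {u, v} = None \<or> ?d {u, v} = Some (u, v)) \<longleftrightarrow> h v \<le> h u" if uv: "{u, v} \<in> E" for u v
    proof -
      have vu: "{v, u} \<in> E" using uv by (simp add: insert_commute)
      consider "h v < h u" | "h u < h v" | "h u = h v"
        using comparable[OF uv] unfolding order_le_less by metis
      then show ?thesis
      proof cases
        case 2
        then show ?thesis
          using height_orientation_Some[OF vu, of h] edge[OF uv] by (auto simp: insert_commute)
      qed (use height_orientation_Some[OF uv, of h] height_orientation_None[OF uv, of h] in auto)
    qed
    then show ?thesis unfolding weak_arcs_def by (simp cong: conj_cong)
  qed
qed

section \<open>Tight sets of the supermodular weight\<close>

definition gweight :: "'n set set \<Rightarrow> 'n set \<Rightarrow> nat" where
  "gweight E U = card U + card (induced_edges E U)"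

definition crossing :: "'n set set \<Rightarrow> 'n set \<Rightarrow> 'n set \<Rightarrow> 'n set set" where
  "crossing E A B = {{u, v} | u v. {u, v} \<in> E \<and> u \<in> A - B \<and> v \<in> B - A}"

text \<open>Vertices are counted modularly, and the edges inside the union that lie in neither set
  are the crossing ones.\<close>

lemma gweight_union_inter:
  fixes E :: "'n::finite set set"
  assumes g: "simple_graph UNIV E"
  shows "gweight E (A \<union> B) + gweight E (A \<inter> B) = gweight E A + gweight E B + card (crossing E A B)"
proof -
  have "induced_edges E (A \<union> B) = (induced_edges E A \<union> induced_edges E B) \<union> crossing E A B"
    (is "?L = ?R")
  proof
    show "?L \<subseteq> ?R"
    proof
      fix e assume e: "e \<in> ?L"
      then obtain u v where uv: "e = {u, v}"
        using g by (auto simp: simple_graph_def induced_edges_def card_2_iff)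
      show "e \<in> ?R"
      proof (cases "e \<subseteq> A \<or> e \<subseteq> B")
        case False
        then have "u \<in> A - B \<and> v \<in> B - A \<or> v \<in> A - B \<and> u \<in> B - A"
          using e uv by (auto simp: induced_edges_def)
        moreover have "{u, v} \<in> E" "{v, u} \<in> E" "e = {v, u}"
          using e uv by (auto simp: induced_edges_def insert_commute)
        ultimately show ?thesis using uv unfolding crossing_def by blast
      qed (use e in \<open>auto simp: induced_edges_def\<close>)
    qed
  qed (auto simp: induced_edges_def crossing_def)
  moreover have "(induced_edges E A \<union> induced_edges E B) \<inter> crossing E A B = {}"
    by (auto simp: induced_edges_def crossing_def)
  ultimately have "card (induced_edges E (A \<union> B)) =
      card (induced_edges E A \<union> induced_edges E B) + card (crossing E A B)"
    by (simp add: card_Un_disjoint)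
  moreover have "induced_edges E (A \<inter> B) = induced_edges E A \<inter> induced_edges E B"
    by (auto simp: induced_edges_def)
  ultimately show ?thesis
    using card_Un_Int[of A B] card_Un_Int[of "induced_edges E A" "induced_edges E B"]
    by (simp add: gweight_def)
qed

lemma gweight_empty:
  assumes "simple_graph UNIV E"
  shows "gweight E {} = 0"
proof -
  have "\<And>e. e \<in> E \<Longrightarrow> e \<noteq> {}" using assms by (auto simp: simple_graph_def)
  then show ?thesis by (auto simp: gweight_def induced_edges_def)
qed

lemma simple_graph_induced:
  fixes E :: "'n::finite set set"
  assumes "simple_graph UNIV E"
  shows "simple_graph \<sigma> (induced_edges E \<sigma>)"
  using assms by (auto simp: simple_graph_def induced_edges_def)

lemma induced_edges_UNIV [simp]: "induced_edges E UNIV = E"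
  by (simp add: induced_edges_def)

text \<open>Here \<open>s U\<close> abstracts the slack of the constraint of \<open>U\<close> at a
  point of height \<open>l\<close>. Coordinate sums are modular, so the whole defect of modularity
  comes from the crossing edges.\<close>

locale graph_slack =
  fixes E :: "'n::finite set set" and s :: "'n set \<Rightarrow> real" and l :: real
  assumes graph: "simple_graph UNIV E"
    and l_pos: "l > 0"
    and nonneg: "s U \<ge> 0"
    and slack_empty: "s {} = 0"
    and modular: "s (A \<union> B) + s (A \<inter> B) + l * card (crossing E A B) = s A + s B"
begin

definition tights :: "'n set set" where
  "tights = {U. s U = 0}"

lemma tights_closed:
  assumes "A \<in> tights" "B \<in> tights"
  shows "A \<union> B \<in> tights" "A \<inter> B \<in> tights" "crossing E A B = {}"
proof -
  have "s (A \<union> B) + s (A \<inter> B) + l * card (crossing E A B) = 0"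
    using modular[of A B] assms by (simp add: tights_def)
  moreover have "l * card (crossing E A B) \<ge> 0" using l_pos by simp
  ultimately have *: "s (A \<union> B) = 0" "s (A \<inter> B) = 0" "l * card (crossing E A B) = 0"
    using nonneg[of "A \<union> B"] nonneg[of "A \<inter> B"] by linarith+
  then show "A \<union> B \<in> tights" "A \<inter> B \<in> tights" "crossing E A B = {}"
    using l_pos by (simp_all add: tights_def)
qed

lemma Union_tights:
  assumes "\<A> \<subseteq> tights"
  shows "\<Union>\<A> \<in> tights"
  using finite[of \<A>] assms
proof (induction rule: finite_induct)
  case empty
  then show ?case by (simp add: tights_def slack_empty)
next
  case (insert A \<A>)
  then show ?case using tights_closed(1) by simp
qed

lemma Inter_tights:
  assumes "\<A> \<noteq> {}" "\<A> \<subseteq> tights"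
  shows "\<Inter>\<A> \<in> tights"
  using finite[of \<A>] assms
proof (induction rule: finite_ne_induct)
  case (insert A \<A>)
  then show ?case using tights_closed(2) by simp
qed simp

definition members :: "'n \<Rightarrow> 'n set set" where
  "members v = {U \<in> tights. v \<in> U}"

text \<open>A tight set containing only \<open>u\<close> and a tight set containing only
  \<open>v\<close> would be crossed by the edge, but tight sets have no crossing edges.\<close>

lemma members_comparable:
  assumes "{u, v} \<in> E"
  shows "members u \<subseteq> members v \<or> members v \<subseteq> members u"
proof (rule ccontr)
  assume "\<not> ?thesis"
  then obtain A B where "A \<in> tights" "u \<in> A" "v \<notin> A" "B \<in> tights" "v \<in> B" "u \<notin> B"
    by (auto simp: members_def)
  then show False
    using tights_closed(3)[of A B] assms by (auto simp: crossing_def)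
qed

text \<open>Induction by peeling off one class \<open>C\<close> of vertices lying in the same tight
  sets. Each class is a difference \<open>D - D'\<close> of tight sets. Two applications of
  modularity to pairs without crossing edges first place all of \<open>C\<close> in \<open>W\<close>
  and then pass tightness from \<open>W - C\<close> to \<open>W\<close>.\<close>

lemma pred_closed_tight:
  assumes "W \<subseteq> \<Union>tights"
    and "\<And>u v. {u, v} \<in> E \<Longrightarrow> u \<in> \<Union>tights \<Longrightarrow> v \<in> W \<Longrightarrow> members v \<subseteq> members u \<Longrightarrow> u \<in> W"
  shows "W \<in> tights"
  using assms
proof (induction "card W" arbitrary: W rule: less_induct)
  case less
  note closed = less.prems(2)
  show ?case
  proof (cases "W = {}")
    case True
    then show ?thesis by (simp add: tights_def slack_empty)
  next
    case False
    \<comment> \<open>Minimality puts the class of \<open>p\<close> at the lower end of the arcs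
      within \<open>W\<close>, so \<open>W\<close> stays closed after its removal.\<close>
    then obtain p where p: "p \<in> W" and min: "\<And>u. u \<in> W \<Longrightarrow> members u \<subseteq> members p \<Longrightarrow> members u = members p"
      using finite_has_minimal[of "members ` W"] by auto
    define D where "D = \<Inter>(members p)"
    \<comment> \<open>\<open>D\<close> is the smallest tight set containing \<open>p\<close>, and
      \<open>D'\<close> is the largest tight subset of \<open>D\<close> avoiding
      \<open>p\<close>.\<close>
    define D' where "D' = \<Union>{U \<in> tights. U \<subseteq> D \<and> p \<notin> U}"
    define C where "C = {u. members u = members p}"
    have "members p \<noteq> {}" using p less.prems(1) by (auto simp: members_def)
    then have D: "D \<in> tights" "p \<in> D"
      unfolding D_def by (auto intro!: Inter_tights simp: members_def)
    have D': "D' \<in> tights" "D' \<subseteq> D" "p \<notin> D'"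
      unfolding D'_def by (auto intro!: Union_tights)
    have mem_D: "u \<in> D \<longleftrightarrow> members p \<subseteq> members u" for u
      by (auto simp: D_def members_def)
    have C_eq: "C = D - D'"
    proof (intro equalityI subsetI)
      fix u assume "u \<in> C"
      then have u: "members u = members p" by (simp add: C_def)
      then have "u \<in> D" using mem_D by simp
      moreover have "u \<notin> D'" using u D' by (auto simp: members_def)
      ultimately show "u \<in> D - D'" by simp
    next
      fix u assume u: "u \<in> D - D'"
      \<comment> \<open>A tight set containing \<open>u\<close> but not \<open>p\<close> would meet
        \<open>D\<close> in one of the sets that form \<open>D'\<close>, contradicting
        \<open>u \<notin> D'\<close>.\<close>
      have "U \<in> members p" if U: "U \<in> members u" for U
      proof (rule ccontr)
        assume "U \<notin> members p"
        then have "U \<inter> D \<in> {U \<in> tights. U \<subseteq> D \<and> p \<notin> U}"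
          using U D tights_closed(2) by (auto simp: members_def)
        then show False using U u by (auto simp: D'_def members_def)
      qed
      then show "u \<in> C" using u mem_D by (auto simp: C_def)
    qed
    have sub: "C \<subseteq> \<Union>tights" using D(1) C_eq by blast
    have "C \<subseteq> W"
    proof -
      \<comment> \<open>No edge joins \<open>C \<inter> W\<close> to \<open>C - W\<close>, so the slack is additive along this splitting of
        \<open>D\<close> over \<open>D'\<close>, and \<open>D' \<union> (C \<inter> W)\<close> is a tight set containing \<open>p\<close>.\<close>
      let ?A = "D' \<union> (C \<inter> W)" and ?B = "D' \<union> (C - W)"
      have "crossing E ?A ?B = {}"
      proof -
        have False if "{u, v} \<in> E" "u \<in> C \<inter> W" "v \<in> C - W" for u v
        proof -
          have "v \<in> \<Union>tights" "{v, u} \<in> E" using that sub by (auto simp: insert_commute)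
          then show False using closed[of v u] that by (simp add: C_def)
        qed
        then show ?thesis unfolding crossing_def by blast
      qed
      moreover have "?A \<union> ?B = D" "?A \<inter> ?B = D'" using C_eq D' by auto
      ultimately have "s ?A + s ?B = 0"
        using modular[of ?A ?B] D D' by (simp add: tights_def)
      then have "?A \<in> tights"
        using nonneg[of ?A] nonneg[of ?B] by (simp add: tights_def)
      moreover have "p \<in> ?A" using p by (simp add: C_def)
      ultimately have "D \<subseteq> ?A" by (auto simp: D_def members_def)
      then show ?thesis using C_eq by blast
    qed
    have "p \<in> C" by (simp add: C_def)
    have "W - C \<in> tights"
    proof (rule less.hyps)
      show "card (W - C) < card W"
        using p \<open>p \<in> C\<close> by (intro psubset_card_mono) auto
      show "W - C \<subseteq> \<Union>tights" using less.prems(1) by blast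
      fix u v assume uv: "{u, v} \<in> E" "u \<in> \<Union>tights" "v \<in> W - C" "members v \<subseteq> members u"
      then have "u \<in> W" using closed by blast
      moreover have "u \<notin> C"
      proof
        assume "u \<in> C"
        then have "members v = members p" using min[of v] uv by (simp add: C_def)
        then show False using uv by (simp add: C_def)
      qed
      ultimately show "u \<in> W - C" by simp
    qed
    \<comment> \<open>\<open>W\<close> and \<open>?B\<close> have the tight union
      \<open>(W - C) \<union> D\<close> and the tight intersection \<open>W - C\<close>. As
      \<open>?B\<close> is tight and no edge crosses, modularity leaves slack \<open>0\<close> for
      \<open>W\<close>.\<close>
    let ?B = "(W - C) \<union> D'"
    have "crossing E W ?B = {}"
    proof -
      have False if uv: "{u, v} \<in> E" "u \<in> C" "v \<in> D' - W" for u v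
      proof -
        have "v \<in> \<Union>tights" "{v, u} \<in> E" "v \<in> D"
          using uv D'(1,2) by (auto simp: insert_commute)
        then show False using closed[of v u] uv mem_D[of v] \<open>C \<subseteq> W\<close> by (auto simp: C_def)
      qed
      then show ?thesis unfolding crossing_def by blast
    qed
    moreover have "W \<union> ?B = (W - C) \<union> D" "W \<inter> ?B = W - C"
      using \<open>C \<subseteq> W\<close> C_eq D' by auto
    moreover have "(W - C) \<union> D \<in> tights" "?B \<in> tights"
      using \<open>W - C \<in> tights\<close> D D' tights_closed(1) by auto
    ultimately show ?thesis
      using modular[of W ?B] \<open>W - C \<in> tights\<close> by (simp add: tights_def)
  qed
qed

lemma tights_eq_pao_ideals:
  defines "\<sigma> \<equiv> \<Union>tights"
  shows "\<exists>d. pao \<sigma> (induced_edges E \<sigma>) d \<and> tights = pao_ideals \<sigma> (induced_edges E \<sigma>) d"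
proof -
  let ?E = "induced_edges E \<sigma>"
  let ?d = "height_orientation members ?E"
  have g: "simple_graph \<sigma> ?E" using graph by (rule simple_graph_induced)
  have comp: "members u \<subseteq> members v \<or> members v \<subseteq> members u" if "{u, v} \<in> ?E" for u v
    using that members_comparable by (auto simp: induced_edges_def)
  have pao: "pao \<sigma> ?E ?d" and weak: "weak_arcs ?E ?d = {(u, v). {u, v} \<in> ?E \<and> members v \<subseteq> members u}"
    using pao_height_orientation[OF g, of members] comp by auto
  have "W \<in> tights \<longleftrightarrow> pred_closed \<sigma> ?E ?d W" for W
  proof
    assume "W \<in> tights"
    then show "pred_closed \<sigma> ?E ?d W"
      unfolding pred_closed_def weak by (auto simp: members_def \<sigma>_def)
  next
    assume W: "pred_closed \<sigma> ?E ?d W"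
    show "W \<in> tights"
    proof (rule pred_closed_tight)
      show "W \<subseteq> \<Union>tights" using W by (auto simp: pred_closed_def \<sigma>_def)
      fix u v assume uv: "{u, v} \<in> E" "u \<in> \<Union>tights" "v \<in> W" "members v \<subseteq> members u"
      then have "{u, v} \<in> ?E" using W by (auto simp: induced_edges_def \<sigma>_def pred_closed_def)
      then show "u \<in> W" using W uv unfolding pred_closed_def weak by blast
    qed
  qed
  then have "tights = pao_ideals \<sigma> ?E ?d"
    unfolding pao_ideals_eq[OF g pao] by blast
  then show ?thesis using pao by blast
qed

end

section \<open>The join as an intersection of halfspaces\<close>

lemma sum_union_inter_vec:
  fixes x :: "real^'n::finite"
  shows "(\<Sum>i\<in>A \<union> B. x $ i) + (\<Sum>i\<in>A \<inter> B. x $ i) = (\<Sum>i\<in>A. x $ i) + (\<Sum>i\<in>B. x $ i)"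
  by (rule sum.union_inter) simp_all

text \<open>Minimize the coordinate sum over the compact set of admissible vectors below
  \<open>x\<close>. At a minimum every coordinate lies in a tight set, since otherwise it could be
  lowered. Supermodularity makes tight sets closed under union, so their union \<open>UNIV\<close>
  is tight.\<close>

lemma supermodular_base_below:
  fixes h :: "'n::finite set \<Rightarrow> real" and x :: "real^'n"
  assumes h_empty: "h {} = 0"
    and supermodular: "\<And>A B. h A + h B \<le> h (A \<union> B) + h (A \<inter> B)"
    and x: "\<And>U. h U \<le> (\<Sum>i\<in>U. x $ i)"
  shows "\<exists>y. (\<forall>i. y $ i \<le> x $ i) \<and> (\<forall>U. h U \<le> (\<Sum>i\<in>U. y $ i)) \<and> (\<Sum>i\<in>UNIV. y $ i) = h UNIV"
proof -
  define S where "S = {y :: real^'n. (\<forall>i. y $ i \<le> x $ i) \<and> (\<forall>U. h U \<le> (\<Sum>i\<in>U. y $ i))}"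
  have "closed S"
    unfolding S_def
    by (intro closed_Collect_conj closed_Collect_all closed_Collect_le continuous_intros)
  moreover have "bounded S"
  proof (rule bounded_subset[OF bounded_cbox])
    show "S \<subseteq> cbox (\<chi> i. h {i}) x"
    proof
      fix y assume y: "y \<in> S"
      then have "h {i} \<le> y $ i" for i
        unfolding S_def by (auto dest: spec[of _ "{i}"])
      then show "y \<in> cbox (\<chi> i. h {i}) x"
        using y by (simp add: mem_box_cart S_def)
    qed
  qed
  ultimately have "compact S" by (simp add: compact_eq_bounded_closed)
  moreover have "S \<noteq> {}" using x by (auto simp: S_def)
  moreover have "continuous_on S (\<lambda>y. \<Sum>i\<in>UNIV. y $ i)"
    by (intro continuous_intros)
  ultimately have "\<exists>y\<in>S. \<forall>z\<in>S. (\<Sum>i\<in>UNIV. y $ i) \<le> (\<Sum>i\<in>UNIV. z $ i)"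
    by (rule continuous_attains_inf)
  then obtain y where y: "y \<in> S"
      and min: "\<And>z. z \<in> S \<Longrightarrow> (\<Sum>i\<in>UNIV. y $ i) \<le> (\<Sum>i\<in>UNIV. z $ i)"
    by (elim bexE) (metis (no_types, lifting))
  define T where "T = {U. (\<Sum>i\<in>U. y $ i) = h U}"
  have h_le: "h U \<le> (\<Sum>i\<in>U. y $ i)" for U using y by (simp add: S_def)
  have un: "A \<union> B \<in> T" if "A \<in> T" "B \<in> T" for A B
    using that sum_union_inter_vec[of y A B] supermodular[of A B] h_le[of "A \<union> B"] h_le[of "A \<inter> B"]
    by (simp add: T_def)
  have cover: "\<exists>U\<in>T. v \<in> U" for v
  proof (rule ccontr)
    assume no: "\<not> (\<exists>U\<in>T. v \<in> U)"
    \<comment> \<open>The least slack among the finitely many sets containing \<open>v\<close> is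
      the amount by which coordinate \<open>v\<close> can be lowered.\<close>
    define \<epsilon> where "\<epsilon> = Min ((\<lambda>U. (\<Sum>i\<in>U. y $ i) - h U) ` {U. v \<in> U})"
    have ne: "{U. v \<in> U} \<noteq> {}" by blast
    have gap: "0 < (\<Sum>i\<in>U. y $ i) - h U" if "v \<in> U" for U
      using no that h_le[of U] by (auto simp: T_def order_less_le)
    have "\<epsilon> > 0"
      unfolding \<epsilon>_def using ne gap by (subst Min_gr_iff) auto
    have \<epsilon>: "\<epsilon> \<le> (\<Sum>i\<in>U. y $ i) - h U" if "v \<in> U" for U
      unfolding \<epsilon>_def using that by (intro Min_le) auto
    define z where "z = y - \<epsilon> *\<^sub>R axis v 1"
    have z_sum: "(\<Sum>i\<in>U. z $ i) = (\<Sum>i\<in>U. y $ i) - (if v \<in> U then \<epsilon> else 0)" for U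
      by (simp add: z_def sum_subtractf axis_def if_distrib[of "\<lambda>c. \<epsilon> * c"] cong: if_cong)
    have "z \<in> S"
    proof -
      have "z $ i \<le> x $ i" for i
        using y \<open>\<epsilon> > 0\<close> unfolding z_def S_def
        by (simp add: axis_def) (smt (verit, best))
      moreover have "h U \<le> (\<Sum>i\<in>U. z $ i)" for U
        using \<epsilon>[of U] h_le[of U] by (cases "v \<in> U") (simp_all add: z_sum)
      ultimately show ?thesis by (simp add: S_def)
    qed
    then show False using min[of z] \<open>\<epsilon> > 0\<close> by (simp add: z_sum)
  qed
  then obtain c where c: "\<And>v. c v \<in> T \<and> v \<in> c v" by metis
  have "(\<Union>v\<in>F. c v) \<in> T" for F :: "'n set"
    using finite[of F]
  proof (induction rule: finite_induct)
    case empty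
    then show ?case by (simp add: T_def h_empty)
  qed (simp add: un c)
  from this[of UNIV] have "UNIV \<in> T" using c by (metis UNIV_eq_I UN_iff UNIV_I)
  then show ?thesis using y by (auto simp: T_def S_def)
qed

lemma dilated_simplex_eq:
  fixes N :: real
  assumes "N > 0"
  shows "dilated_simplex N = {t :: real^'n::finite. (\<forall>i. 0 \<le> t $ i) \<and> (\<Sum>i\<in>UNIV. t $ i) = N}"
    (is "_ = ?S")
proof
  have "convex ?S"
  proof (rule convexI)
    fix x y :: "real^'n" and u v :: real
    assume *: "x \<in> ?S" "y \<in> ?S" "0 \<le> u" "0 \<le> v" "u + v = 1"
    have "(\<Sum>i\<in>UNIV. (u *\<^sub>R x + v *\<^sub>R y) $ i) = u * N + v * N"
      using * by (simp add: sum.distrib flip: sum_distrib_left)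
    also have "\<dots> = N" using * by (simp flip: distrib_right)
    finally show "u *\<^sub>R x + v *\<^sub>R y \<in> ?S" using * by simp
  qed
  moreover have "N *\<^sub>R axis i 1 \<in> ?S" for i :: 'n
    using assms by (simp add: axis_def if_distrib[of "\<lambda>c. N * c"] cong: if_cong)
  ultimately show "dilated_simplex N \<subseteq> ?S"
    unfolding dilated_simplex_def by (intro hull_minimal) blast+
next
  show "?S \<subseteq> dilated_simplex N"
  proof
    fix t :: "real^'n" assume t: "t \<in> ?S"
    have "(\<Sum>i\<in>UNIV. (t $ i / N) *\<^sub>R (N *\<^sub>R axis i 1)) \<in> dilated_simplex N"
      unfolding dilated_simplex_def
    proof (rule convex_sum)
      show "(\<Sum>i\<in>UNIV. t $ i / N) = 1"
        using t assms by (simp flip: sum_divide_distrib)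
    qed (use t assms in \<open>auto intro: hull_inc\<close>)
    also have "(\<Sum>i\<in>UNIV. (t $ i / N) *\<^sub>R (N *\<^sub>R axis i 1)) = t"
      using assms by (simp add: vec_eq_iff axis_def if_distrib[of "\<lambda>c. _ * c"] cong: if_cong)
    finally show "t \<in> dilated_simplex N" .
  qed
qed

section \<open>Half-space description of the join\<close>

locale graph_join =
  fixes E :: "'n::finite set set" and N :: real
  assumes graph: "simple_graph UNIV E"
    and N_pos: "N > 0"
    and N_neq: "N \<noteq> real (gweight E UNIV)"
begin

abbreviation M :: real where
  "M \<equiv> real (gweight E UNIV)"

text \<open>The height \<open>lam\<close> is \<open>0\<close> on the simplex and \<open>1\<close> on the graph polytope.\<close>

definition lam :: "real^'n \<Rightarrow> real" where
  "lam x = ((\<Sum>i\<in>UNIV. x $ i) - N) / (M - N)"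

text \<open>\<open>None\<close> indexes \<open>lam x \<ge> 0\<close> and \<open>Some U\<close> the
  constraint of \<open>U\<close>. As \<open>lam\<close> is only affine, its constant part moves into
  \<open>bound\<close>.\<close>

definition normal :: "'n set option \<Rightarrow> real^'n" where
  "normal c = (case c of None \<Rightarrow> (\<chi> i. 1 / (M - N))
     | Some U \<Rightarrow> (\<chi> i. (if i \<in> U then 1 else 0) - gweight E U / (M - N)))"

definition bound :: "'n set option \<Rightarrow> real" where
  "bound c = (case c of None \<Rightarrow> N / (M - N) | Some U \<Rightarrow> - (gweight E U * N / (M - N)))"

sublocale halfspace_system normal bound .

lemma normal_None: "normal None \<bullet> z = (\<Sum>i\<in>UNIV. z $ i) / (M - N)"
  by (simp add: normal_def inner_vec_def sum_divide_distrib)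

lemma normal_Some:
  "normal (Some U) \<bullet> z = (\<Sum>i\<in>U. z $ i) - gweight E U * ((\<Sum>i\<in>UNIV. z $ i) / (M - N))"
proof -
  have "normal (Some U) \<bullet> z =
      (\<Sum>i\<in>UNIV. (if i \<in> U then z $ i else 0) - gweight E U / (M - N) * z $ i)"
    unfolding normal_def inner_vec_def by (intro sum.cong) (auto simp: algebra_simps)
  also have "\<dots> = (\<Sum>i\<in>U. z $ i) - gweight E U / (M - N) * (\<Sum>i\<in>UNIV. z $ i)"
    by (simp add: sum_subtractf sum.If_cases sum_distrib_left)
  finally show ?thesis by simp
qed

lemma slack_None: "normal None \<bullet> x - bound None = lam x"
  by (simp add: normal_None bound_def lam_def diff_divide_distrib)

lemma slack_Some: "normal (Some U) \<bullet> x - bound (Some U) = (\<Sum>i\<in>U. x $ i) - gweight E U * lam x"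
  by (simp add: normal_Some bound_def lam_def diff_divide_distrib algebra_simps)

lemma mem_polyh: "x \<in> polyh \<longleftrightarrow> 0 \<le> lam x \<and> (\<forall>U. gweight E U * lam x \<le> (\<Sum>i\<in>U. x $ i))"
proof -
  have "x \<in> polyh \<longleftrightarrow> (\<forall>c. 0 \<le> normal c \<bullet> x - bound c)" by (simp add: polyh_def)
  also have "\<dots> \<longleftrightarrow> 0 \<le> normal None \<bullet> x - bound None \<and> (\<forall>U. 0 \<le> normal (Some U) \<bullet> x - bound (Some U))"
    by (metis option.exhaust)
  finally show ?thesis unfolding slack_None slack_Some by simp
qed

lemma None_mem_tight: "None \<in> tight x \<longleftrightarrow> lam x = 0"
  using slack_None[of x] by (auto simp: tight_def)

lemma Some_mem_tight: "Some U \<in> tight x \<longleftrightarrow> (\<Sum>i\<in>U. x $ i) = gweight E U * lam x"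
  using slack_Some[of U x] by (auto simp: tight_def)

lemma sum_eq_lam: "(\<Sum>i\<in>UNIV. x $ i) = N + lam x * (M - N)"
  using N_neq by (simp add: lam_def)

lemma polyh_nonneg: "x \<in> polyh \<Longrightarrow> 0 \<le> x $ i"
proof -
  assume "x \<in> polyh"
  then have "gweight E {i} * lam x \<le> x $ i" "0 \<le> gweight E {i} * lam x"
    unfolding mem_polyh by (auto dest: spec[of _ "{i}"])
  then show ?thesis by linarith
qed

lemma polyh_lam_le_1: "x \<in> polyh \<Longrightarrow> lam x \<le> 1"
proof -
  assume "x \<in> polyh"
  then have "M * lam x \<le> (\<Sum>i\<in>UNIV. x $ i)" unfolding mem_polyh by blast
  then have "N * lam x \<le> N * 1" unfolding sum_eq_lam by (simp add: algebra_simps)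
  then show ?thesis using N_pos by simp
qed

lemma bounded_polyh: "bounded polyh"
proof (rule bounded_subset[OF bounded_cbox])
  show "polyh \<subseteq> cbox 0 (\<chi> i. N + M)"
  proof
    fix x assume x: "x \<in> polyh"
    have "x $ i \<le> N + M" for i
    proof -
      have "x $ i \<le> (\<Sum>i\<in>UNIV. x $ i)"
        using polyh_nonneg[OF x] by (intro member_le_sum) auto
      also have "\<dots> = N * (1 - lam x) + lam x * M"
        unfolding sum_eq_lam by (simp add: algebra_simps)
      also have "\<dots> \<le> N * 1 + 1 * M"
        using x N_pos polyh_lam_le_1[OF x] by (intro add_mono mult_mono) (auto simp: mem_polyh)
      finally show ?thesis by simp
    qed
    then show "x \<in> cbox 0 (\<chi> i. N + M)"
      using polyh_nonneg[OF x] by (simp add: mem_box_cart)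
  qed
qed

lemma graph_polytope_eq:
  "graph_polytope E = {x. (\<Sum>i\<in>UNIV. x $ i) = M \<and> (\<forall>U. gweight E U \<le> (\<Sum>i\<in>U. x $ i))}"
  by (simp add: graph_polytope_def gweight_def)

lemma scaled_base_below:
  fixes l :: real and x :: "real^'n"
  assumes "0 \<le> l" "\<And>U. gweight E U * l \<le> (\<Sum>i\<in>U. x $ i)"
  shows "\<exists>y. (\<forall>i. y $ i \<le> x $ i) \<and> (\<forall>U. gweight E U * l \<le> (\<Sum>i\<in>U. y $ i)) \<and>
    (\<Sum>i\<in>UNIV. y $ i) = M * l"
proof (rule supermodular_base_below)
  show "gweight E {} * l = 0" by (simp add: gweight_empty[OF graph])
  fix A B
  have "gweight E A + gweight E B \<le> gweight E (A \<union> B) + gweight E (A \<inter> B)"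
    using gweight_union_inter[OF graph, of A B] by simp
  then have "(gweight E A + gweight E B) * l \<le> (gweight E (A \<union> B) + gweight E (A \<inter> B)) * l"
    using assms(1) by (intro mult_right_mono) linarith+
  then show "gweight E A * l + gweight E B * l \<le> gweight E (A \<union> B) * l + gweight E (A \<inter> B) * l"
    by (simp add: distrib_right)
qed (use assms in auto)

lemma graph_polytope_nonempty: "graph_polytope E \<noteq> {}"
proof -
  \<comment> \<open>The constant vector \<open>M\<close> dominates all weights; a base vector below
    it is a point of the graph polytope.\<close>
  have "real (gweight E U) * 1 \<le> (\<Sum>i\<in>U. (\<chi> i. M) $ i)" for U :: "'n set"
  proof (cases "U = {}")
    case True
    then show ?thesis by (simp add: gweight_empty[OF graph])
  next
    case False
    have "gweight E U \<le> gweight E UNIV"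
      unfolding gweight_def by (intro add_mono card_mono) (auto simp: induced_edges_def)
    moreover have "1 \<le> card U" using False by (simp add: Suc_le_eq card_gt_0_iff)
    then have "1 * M \<le> card U * M" by (intro mult_right_mono) auto
    ultimately show ?thesis by simp
  qed
  from scaled_base_below[OF _ this] show ?thesis
    unfolding graph_polytope_eq by auto
qed

lemma dilated_simplex_nonempty: "dilated_simplex N \<noteq> ({} :: (real^'n) set)"
  by (simp add: dilated_simplex_def)

lemma lam_0_iff: "x \<in> polyh \<and> lam x = 0 \<longleftrightarrow> x \<in> dilated_simplex N"
proof
  assume x: "x \<in> polyh \<and> lam x = 0"
  then show "x \<in> dilated_simplex N"
    unfolding dilated_simplex_eq[OF N_pos] using polyh_nonneg sum_eq_lam[of x] by simp
next
  assume x: "x \<in> dilated_simplex N"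
  then have *: "\<And>i. 0 \<le> x $ i" "(\<Sum>i\<in>UNIV. x $ i) = N"
    unfolding dilated_simplex_eq[OF N_pos] by auto
  then have "lam x = 0" by (simp add: lam_def)
  then show "x \<in> polyh \<and> lam x = 0" using * by (simp add: mem_polyh sum_nonneg)
qed

lemma join_eq_polyh: "join (graph_polytope E) (dilated_simplex N) = polyh"
proof
  show "join (graph_polytope E) (dilated_simplex N) \<subseteq> polyh"
  proof
    fix x assume "x \<in> join (graph_polytope E) (dilated_simplex N)"
    then obtain \<alpha> s t where x: "x = \<alpha> *\<^sub>R s + (1 - \<alpha>) *\<^sub>R t" "0 \<le> \<alpha>" "\<alpha> \<le> 1"
        and s: "s \<in> graph_polytope E" and t: "t \<in> dilated_simplex N"
      unfolding join_def by blast
    have t: "\<And>i. 0 \<le> t $ i" "(\<Sum>i\<in>UNIV. t $ i) = N"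
      using t unfolding dilated_simplex_eq[OF N_pos] by auto
    have sum_x: "(\<Sum>i\<in>U. x $ i) = \<alpha> * (\<Sum>i\<in>U. s $ i) + (1 - \<alpha>) * (\<Sum>i\<in>U. t $ i)" for U
      unfolding x by (simp add: sum.distrib flip: sum_distrib_left)
    have "(\<Sum>i\<in>UNIV. x $ i) - N = \<alpha> * (M - N)"
      unfolding sum_x using s t by (simp add: graph_polytope_eq algebra_simps)
    then have lam: "lam x = \<alpha>" using N_neq by (simp add: lam_def)
    have "gweight E U * \<alpha> \<le> (\<Sum>i\<in>U. x $ i)" for U
    proof -
      have "gweight E U * \<alpha> \<le> \<alpha> * (\<Sum>i\<in>U. s $ i)"
        using s x(2) by (subst mult.commute) (intro mult_left_mono; simp add: graph_polytope_eq)
      moreover have "0 \<le> (1 - \<alpha>) * (\<Sum>i\<in>U. t $ i)"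
        using x(3) t by (intro mult_nonneg_nonneg sum_nonneg) auto
      ultimately show ?thesis unfolding sum_x by linarith
    qed
    then show "x \<in> polyh" using x lam by (simp add: mem_polyh)
  qed
next
  show "polyh \<subseteq> join (graph_polytope E) (dilated_simplex N)"
  proof
    fix x assume x: "x \<in> polyh"
    define l where "l = lam x"
    have l: "0 \<le> l" "l \<le> 1" using x polyh_lam_le_1 by (auto simp: l_def mem_polyh)
    have x_ge: "gweight E U * l \<le> (\<Sum>i\<in>U. x $ i)" for U
      using x by (simp add: l_def mem_polyh)
    obtain s t where "s \<in> graph_polytope E" "t \<in> dilated_simplex N" "x = l *\<^sub>R s + (1 - l) *\<^sub>R t"
    proof (cases "l = 0 \<or> l = 1")
      case True
      obtain s0 t0 :: "real^'n" where "s0 \<in> graph_polytope E" "t0 \<in> dilated_simplex N"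
        using graph_polytope_nonempty dilated_simplex_nonempty by blast
      moreover have "x \<in> dilated_simplex N" if "l = 0"
        using lam_0_iff[of x] x that by (simp add: l_def)
      moreover have "x \<in> graph_polytope E" if "l = 1"
        using x_ge sum_eq_lam[of x] that by (simp add: l_def graph_polytope_eq)
      ultimately show ?thesis
        \<comment> \<open>At the two end heights the other point has coefficient \<open>0\<close>,
          so any point of the other polytope will do.\<close>
        using True that[of s0 x] that[of x t0] by auto
    next
      case False
      then have l': "0 < l" "l < 1" using l by auto
      \<comment> \<open>\<open>y\<close> is the part of \<open>x\<close> coming from the graph
        polytope. The rest \<open>x - y\<close> is nonnegative with coordinate sum
        \<open>N * (1 - l)\<close>, hence a multiple of a simplex point.\<close>
      obtain y where y: "\<And>i. y $ i \<le> x $ i" "\<And>U. gweight E U * l \<le> (\<Sum>i\<in>U. y $ i)"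
          "(\<Sum>i\<in>UNIV. y $ i) = M * l"
        using scaled_base_below[OF l(1) x_ge] by blast
      have "(1 / l) *\<^sub>R y \<in> graph_polytope E"
        unfolding graph_polytope_eq using y l'
        by (simp add: pos_le_divide_eq flip: sum_divide_distrib)
      moreover have "(1 / (1 - l)) *\<^sub>R (x - y) \<in> dilated_simplex N"
      proof -
        have "(\<Sum>i\<in>UNIV. (x - y) $ i) = N * (1 - l)"
          using y(3) sum_eq_lam[of x] by (simp add: sum_subtractf l_def algebra_simps)
        then show ?thesis
          unfolding dilated_simplex_eq[OF N_pos] using y l'
          by (simp flip: sum_divide_distrib)
      qed
      moreover have "x = l *\<^sub>R ((1 / l) *\<^sub>R y) + (1 - l) *\<^sub>R ((1 / (1 - l)) *\<^sub>R (x - y))"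
        using l' by simp
      ultimately show ?thesis by (rule that)
    qed
    then show "x \<in> join (graph_polytope E) (dilated_simplex N)"
      unfolding join_def using l by blast
  qed
qed

end

section \<open>Points realizing prescribed tight sets\<close>

text \<open>Every edge hands out its weight so that a vertex set always receives at least one unit for each
  edge it contains, with equality exactly for the ideals of the orientation.\<close>

definition edge_share :: "'a set \<Rightarrow> 'a orientation \<Rightarrow> 'a set \<Rightarrow> 'a \<Rightarrow> real" where
  "edge_share \<sigma> d e v = (if v \<notin> e then 0
     else if e \<subseteq> \<sigma> then (case d e of None \<Rightarrow> 1 / 2 | Some p \<Rightarrow> of_bool (v = snd p))
     else of_bool (v \<notin> \<sigma>))"

text \<open>A directed edge inside \<open>\<sigma>\<close> pays its head one unit and an undirected
  one pays half to each end, so \<open>U\<close> gets too much exactly when it contains a paid end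
  but not the whole edge. An edge leaving \<open>\<sigma>\<close> pays only vertices outside
  \<open>\<sigma>\<close>, hence nothing to a set inside it.\<close>

lemma edge_share_sum:
  fixes E :: "'n::finite set set"
  assumes g: "simple_graph UNIV E" and d: "d \<in> orientations (induced_edges E \<sigma>)" and e: "e \<in> E"
  shows "of_bool (e \<subseteq> U) \<le> (\<Sum>v\<in>U. edge_share \<sigma> d e v)"
    and "U \<subseteq> \<sigma> \<Longrightarrow> (\<Sum>v\<in>U. edge_share \<sigma> d e v) = of_bool (e \<subseteq> U) \<longleftrightarrow>
      (\<forall>u v. e = {u, v} \<longrightarrow> (u, v) \<in> weak_arcs (induced_edges E \<sigma>) d \<longrightarrow> v \<in> U \<longrightarrow> u \<in> U)"
proof -
  obtain a b where ab: "e = {a, b}" "a \<noteq> b"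
    using g e by (auto simp: simple_graph_def card_2_iff)
  have sum: "(\<Sum>v\<in>U. edge_share \<sigma> d e v) =
      (if a \<in> U then edge_share \<sigma> d e a else 0) + (if b \<in> U then edge_share \<sigma> d e b else 0)"
  proof -
    have "(\<Sum>v\<in>U. edge_share \<sigma> d e v) = (\<Sum>v\<in>U \<inter> e. edge_share \<sigma> d e v)"
      by (rule sum.mono_neutral_right) (auto simp: edge_share_def)
    also have "\<dots> = (\<Sum>v\<in>{a, b}. if v \<in> U then edge_share \<sigma> d e v else 0)"
      using ab(1) by (subst sum.inter_restrict[symmetric]) (auto simp: Int_commute)
    finally show ?thesis using ab by simp
  qed
  have iff: "(\<forall>u v. e = {u, v} \<longrightarrow> P u v) \<longleftrightarrow> P a b \<and> P b a" for P
    using ab by (auto simp: doubleton_eq_iff)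
  have weak: "(u, v) \<in> weak_arcs (induced_edges E \<sigma>) d \<longleftrightarrow>
      e \<subseteq> \<sigma> \<and> (d e = None \<or> d e = Some (u, v))" if "e = {u, v}" for u v
    using that e by (auto simp: weak_arcs_def induced_edges_def)
  have ba: "e = {b, a}" using ab by auto
  have "of_bool (e \<subseteq> U) \<le> (\<Sum>v\<in>U. edge_share \<sigma> d e v) \<and> (U \<subseteq> \<sigma> \<longrightarrow>
    (\<Sum>v\<in>U. edge_share \<sigma> d e v) = of_bool (e \<subseteq> U) \<longleftrightarrow>
    (\<forall>u v. e = {u, v} \<longrightarrow> (u, v) \<in> weak_arcs (induced_edges E \<sigma>) d \<longrightarrow> v \<in> U \<longrightarrow> u \<in> U))"
  proof (cases "e \<subseteq> \<sigma>")
    case True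
    then have e': "e \<in> induced_edges E \<sigma>" using e by (simp add: induced_edges_def)
    have "d e \<in> insert None {Some (u, v) | u v. e = {u, v}}"
      using PiE_mem[OF d[unfolded orientations_def] e'] .
    then consider "d e = None" | "d e = Some (a, b)" | "d e = Some (b, a)"
      using ab by (auto simp: doubleton_eq_iff)
    then show ?thesis
      unfolding iff weak[OF ab(1)] weak[OF ba] sum
      using True ab by cases (auto simp: edge_share_def)
  next
    case False
    then show ?thesis
      unfolding iff weak[OF ab(1)] weak[OF ba] sum
      using ab by (auto simp: edge_share_def)
  qed
  then show "of_bool (e \<subseteq> U) \<le> (\<Sum>v\<in>U. edge_share \<sigma> d e v)"
    and "U \<subseteq> \<sigma> \<Longrightarrow> (\<Sum>v\<in>U. edge_share \<sigma> d e v) = of_bool (e \<subseteq> U) \<longleftrightarrow>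
      (\<forall>u v. e = {u, v} \<longrightarrow> (u, v) \<in> weak_arcs (induced_edges E \<sigma>) d \<longrightarrow> v \<in> U \<longrightarrow> u \<in> U)"
    by auto
qed

lemma pao_weight_vector:
  fixes E :: "'n::finite set set"
  assumes g: "simple_graph UNIV E" and d: "pao \<sigma> (induced_edges E \<sigma>) d"
  shows "\<exists>y :: real^'n. \<forall>U. real (gweight E U) \<le> (\<Sum>i\<in>U. y $ i) \<and>
    ((\<Sum>i\<in>U. y $ i) = gweight E U \<longleftrightarrow> U \<in> pao_ideals \<sigma> (induced_edges E \<sigma>) d)"
proof -
  let ?E = "induced_edges E \<sigma>" and ?w = "edge_share \<sigma> d"
  have or: "d \<in> orientations ?E" using d by (auto simp: pao_def pao_witness_def)
  \<comment> \<open>The first unit pays for the vertex itself. The extra unit outside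
    \<open>\<sigma>\<close> prevents sets leaving \<open>\<sigma>\<close> from being tight, even
    where no edge does so.\<close>
  define y :: "real^'n" where "y = (\<chi> v. 1 + of_bool (v \<notin> \<sigma>) + (\<Sum>e\<in>E. ?w e v))"
  define excess where "excess e U = (\<Sum>v\<in>U. ?w e v) - of_bool (e \<subseteq> U)" for e U
  have nonneg: "0 \<le> excess e U" if "e \<in> E" for e U
    using edge_share_sum(1)[OF g or that] by (simp add: excess_def)
  have y: "(\<Sum>i\<in>U. y $ i) = gweight E U + card (U - \<sigma>) + (\<Sum>e\<in>E. excess e U)" for U
  proof -
    have "(\<Sum>i\<in>U. \<Sum>e\<in>E. ?w e i) = (\<Sum>e\<in>E. \<Sum>i\<in>U. ?w e i)" by (rule sum.swap)
    moreover have "(\<Sum>i\<in>U. of_bool (i \<notin> \<sigma>)) = real (card (U - \<sigma>))"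
      by (simp add: of_bool_def sum.If_cases Diff_eq Collect_neg_eq)
    moreover have "(\<Sum>e\<in>E. of_bool (e \<subseteq> U)) = real (card (induced_edges E U))"
      by (simp add: of_bool_def sum.If_cases induced_edges_def Int_def)
    ultimately show ?thesis
      by (simp add: y_def excess_def gweight_def sum.distrib sum_subtractf)
  qed
  have "U \<in> pao_ideals \<sigma> ?E d \<longleftrightarrow> U \<subseteq> \<sigma> \<and> (\<forall>e\<in>E. excess e U = 0)" for U
  proof -
    have "(\<forall>(u, v)\<in>weak_arcs ?E d. v \<in> U \<longrightarrow> u \<in> U) \<longleftrightarrow> (\<forall>e\<in>E. excess e U = 0)" if "U \<subseteq> \<sigma>"
    proof -
      have "excess e U = 0 \<longleftrightarrow> (\<forall>u v. e = {u, v} \<longrightarrow> (u, v) \<in> weak_arcs ?E d \<longrightarrow> v \<in> U \<longrightarrow> u \<in> U)"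
        if "e \<in> E" for e
        using edge_share_sum(2)[OF g or that \<open>U \<subseteq> \<sigma>\<close>] by (simp add: excess_def)
      moreover have "{u, v} \<in> E" if "(u, v) \<in> weak_arcs ?E d" for u v
        using that by (simp add: weak_arcs_def induced_edges_def)
      ultimately show ?thesis by fast
    qed
    then show ?thesis
      unfolding pao_ideals_eq[OF simple_graph_induced[OF g] d] pred_closed_def by auto
  qed
  moreover have "gweight E U \<le> (\<Sum>i\<in>U. y $ i)" for U
    unfolding y using sum_nonneg[of E "\<lambda>e. excess e U"] nonneg[of _ U] by simp
  moreover have "(\<Sum>i\<in>U. y $ i) = gweight E U \<longleftrightarrow> U \<subseteq> \<sigma> \<and> (\<forall>e\<in>E. excess e U = 0)" for U
  proof -
    have "(\<Sum>i\<in>U. y $ i) = gweight E U \<longleftrightarrow> real (card (U - \<sigma>)) = 0 \<and> (\<Sum>e\<in>E. excess e U) = 0"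
    proof -
      have "0 \<le> (\<Sum>e\<in>E. excess e U)" using nonneg by (intro sum_nonneg) auto
      then show ?thesis unfolding y of_nat_add using of_nat_0_le_iff[of "card (U - \<sigma>)"] by linarith
    qed
    also have "(\<Sum>e\<in>E. excess e U) = 0 \<longleftrightarrow> (\<forall>e\<in>E. excess e U = 0)"
      using nonneg by (intro sum_nonneg_eq_0_iff) auto
    finally show ?thesis by auto
  qed
  ultimately show ?thesis by (intro exI[of _ y]) auto
qed

section \<open>Tight sets of the join and the abstract cells\<close>

lemma option_set_eqI:
  assumes "None \<in> X \<longleftrightarrow> None \<in> Y" "\<And>U. Some U \<in> X \<longleftrightarrow> Some U \<in> Y"
  shows "X = Y"
  using assms by (metis option.exhaust set_eqI)

context graph_join
begin

text \<open>The constraints tight at a relative interior point of the corresponding face. A subset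
  \<open>A\<close> stands for the face of the simplex with vertex set \<open>A\<close>, whose
  interior points have support \<open>A\<close>.\<close>

fun label :: "'n ycell \<Rightarrow> 'n set option set" where
  "label (Subset A) = insert None (Some ` {U. U \<inter> A = {}})"
| "label (Oriented \<sigma> d) = Some ` pao_ideals \<sigma> (induced_edges E \<sigma>) d"

lemma ideals_subset:
  assumes "pao \<sigma> (induced_edges E \<sigma>) d" "U \<in> pao_ideals \<sigma> (induced_edges E \<sigma>) d"
  shows "U \<subseteq> \<sigma>"
  using assms pao_ideals_eq[OF simple_graph_induced[OF graph] assms(1)]
  by (simp add: pred_closed_def)

lemma whole_ideal:
  assumes "pao \<sigma> (induced_edges E \<sigma>) d"
  shows "\<sigma> \<in> pao_ideals \<sigma> (induced_edges E \<sigma>) d"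
  using whole_mem_pao_ideals[OF simple_graph_induced[OF graph] assms] .

text \<open>The orientation of the empty graph stands for the whole polytope; realizing its label
  gives an interior point.\<close>

lemma pao_on_empty:
  "\<exists>d. pao {} (induced_edges E {}) d \<and> pao_ideals {} (induced_edges E {}) d = {{}}"
proof -
  have g: "simple_graph {} (induced_edges E {})" using graph by (rule simple_graph_induced)
  have "pao {} (induced_edges E {}) (height_orientation (\<lambda>_. 0 :: nat) (induced_edges E {}))"
    by (rule pao_height_orientation(1)[OF g]) simp
  then show ?thesis using ideals_subset whole_ideal by blast
qed

lemma label_Subset_realized:
  assumes "A \<noteq> {}"
  shows "label (Subset A) \<in> tight ` polyh"
proof -
  \<comment> \<open>The barycenter of the face of the simplex spanned by \<open>A\<close>.\<close>
  define x :: "real^'n" where "x = (\<chi> i. if i \<in> A then N / card A else 0)"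
  have A: "0 < card A" using assms by (simp add: card_gt_0_iff)
  have sum: "(\<Sum>i\<in>U. x $ i) = card (U \<inter> A) * (N / card A)" for U
    by (simp add: x_def sum.If_cases)
  have "lam x = 0" unfolding lam_def sum using A assms by simp
  have "x \<in> polyh"
    unfolding mem_polyh \<open>lam x = 0\<close> sum using N_pos by simp
  moreover have "tight x = label (Subset A)"
  proof (rule option_set_eqI)
    show "Some U \<in> tight x \<longleftrightarrow> Some U \<in> label (Subset A)" for U
      unfolding Some_mem_tight \<open>lam x = 0\<close> sum using A N_pos by auto
  qed (simp add: None_mem_tight \<open>lam x = 0\<close>)
  ultimately show ?thesis by (metis imageI)
qed

lemma label_Oriented_realized:
  assumes d: "pao \<sigma> (induced_edges E \<sigma>) d"
  shows "label (Oriented \<sigma> d) \<in> tight ` polyh"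
proof -
  obtain y :: "real^'n" where y: "\<And>U. real (gweight E U) \<le> (\<Sum>i\<in>U. y $ i)"
      "\<And>U. (\<Sum>i\<in>U. y $ i) = gweight E U \<longleftrightarrow> U \<in> pao_ideals \<sigma> (induced_edges E \<sigma>) d"
    using pao_weight_vector[OF graph d] by blast
  \<comment> \<open>The factor solves \<open>lam (t *\<^sub>R y) = t\<close>, so the constraints at
    \<open>x\<close> are those of \<open>y\<close> multiplied by \<open>t\<close>. The denominator
    is positive because the coordinate sum of \<open>y\<close> is at least \<open>M\<close>.\<close>
  define t where "t = N / ((\<Sum>i\<in>UNIV. y $ i) - M + N)"
  define x where "x = t *\<^sub>R y"
  have pos: "0 < (\<Sum>i\<in>UNIV. y $ i) - M + N" using y(1)[of UNIV] N_pos by simp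
  then have "t > 0" using N_pos by (simp add: t_def)
  have sum: "(\<Sum>i\<in>U. x $ i) = t * (\<Sum>i\<in>U. y $ i)" for U
    by (simp add: x_def flip: sum_distrib_left)
  have "t * ((\<Sum>i\<in>UNIV. y $ i) - M + N) = N" using pos by (simp add: t_def)
  then have "(\<Sum>i\<in>UNIV. x $ i) - N = t * (M - N)"
    unfolding sum by (simp add: algebra_simps)
  then have lam: "lam x = t" using N_neq by (simp add: lam_def)
  have "x \<in> polyh"
    unfolding mem_polyh lam sum using \<open>t > 0\<close> y(1) by (simp add: mult.commute mult_left_mono)
  moreover have "tight x = label (Oriented \<sigma> d)"
  proof (rule option_set_eqI)
    show "Some U \<in> tight x \<longleftrightarrow> Some U \<in> label (Oriented \<sigma> d)" for U
      unfolding Some_mem_tight lam sum using \<open>t > 0\<close> y(2)[of U] by (auto simp: mult.commute)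
  qed (use \<open>t > 0\<close> in \<open>auto simp: None_mem_tight lam\<close>)
  ultimately show ?thesis by (metis imageI)
qed

section \<open>Classification of the tight sets\<close>

lemma tight_lam_0:
  assumes x: "x \<in> polyh" and lam: "lam x = 0"
  shows "\<exists>A. A \<noteq> {} \<and> tight x = label (Subset A)"
proof -
  define A where "A = {i. x $ i \<noteq> 0}"
  have "A \<noteq> {}"
  proof
    assume "A = {}"
    then have "(\<Sum>i\<in>UNIV. x $ i) = 0" by (auto simp: A_def)
    then show False using sum_eq_lam[of x] lam N_pos by simp
  qed
  moreover have "tight x = label (Subset A)"
  proof (rule option_set_eqI)
    fix U
    have "(\<Sum>i\<in>U. x $ i) = 0 \<longleftrightarrow> (\<forall>i\<in>U. x $ i = 0)"
      using polyh_nonneg[OF x] by (intro sum_nonneg_eq_0_iff) auto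
    then show "Some U \<in> tight x \<longleftrightarrow> Some U \<in> label (Subset A)"
      unfolding Some_mem_tight lam by (auto simp: A_def)
  qed (simp add: None_mem_tight lam)
  ultimately show ?thesis by blast
qed

lemma tight_lam_pos:
  assumes x: "x \<in> polyh" and lam: "lam x \<noteq> 0"
  shows "\<exists>\<sigma> d. pao \<sigma> (induced_edges E \<sigma>) d \<and> tight x = label (Oriented \<sigma> d)"
proof -
  have "lam x > 0" using assms by (simp add: mem_polyh)
  interpret s: graph_slack E "\<lambda>U. (\<Sum>i\<in>U. x $ i) - gweight E U * lam x" "lam x"
  proof
    show "0 \<le> (\<Sum>i\<in>U. x $ i) - gweight E U * lam x" for U
      using x by (simp add: mem_polyh)
    fix A B
    have "(real (gweight E (A \<union> B)) + gweight E (A \<inter> B)) * lam x =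
        (real (gweight E A) + gweight E B + card (crossing E A B)) * lam x"
      using gweight_union_inter[OF graph, of A B] by (metis of_nat_add)
    then show "(\<Sum>i\<in>A \<union> B. x $ i) - gweight E (A \<union> B) * lam x +
        ((\<Sum>i\<in>A \<inter> B. x $ i) - gweight E (A \<inter> B) * lam x) + lam x * card (crossing E A B) =
        (\<Sum>i\<in>A. x $ i) - gweight E A * lam x + ((\<Sum>i\<in>B. x $ i) - gweight E B * lam x)"
      using sum_union_inter_vec[of x A B] by (simp add: algebra_simps)
  qed (use graph \<open>lam x > 0\<close> gweight_empty[OF graph] in auto)
  obtain d where d: "pao (\<Union>s.tights) (induced_edges E (\<Union>s.tights)) d"
      "s.tights = pao_ideals (\<Union>s.tights) (induced_edges E (\<Union>s.tights)) d"
    using s.tights_eq_pao_ideals by blast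
  have "tight x = Some ` s.tights"
    by (rule option_set_eqI)
      (use lam in \<open>auto simp: None_mem_tight Some_mem_tight s.tights_def\<close>)
  also have "\<dots> = label (Oriented (\<Union>s.tights) d)" using d(2) by simp
  finally show ?thesis using d(1) by blast
qed

lemma label_UNIV: "label (Subset UNIV) = {None, Some {}}"
  by auto

lemma label_Oriented_empty:
  assumes "pao {} (induced_edges E {}) d"
  shows "label (Oriented {} d) = {Some {}}"
  using ideals_subset[OF assms] whole_ideal[OF assms] by auto

lemma tight_image: "tight ` polyh = label ` ycells E \<union> {{Some {}}, {None, Some {}}}"
proof (intro equalityI subsetI)
  fix T assume "T \<in> tight ` polyh"
  then obtain x where x: "x \<in> polyh" "T = tight x" by blast
  show "T \<in> label ` ycells E \<union> {{Some {}}, {None, Some {}}}"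
  proof (cases "lam x = 0")
    case True
    then obtain A where A: "A \<noteq> {}" "T = label (Subset A)" using tight_lam_0 x by blast
    show ?thesis
    proof (cases "A = UNIV")
      case True
      then show ?thesis using A label_UNIV by simp
    next
      case False
      then have "Subset A \<in> ycells E" using A by (auto simp: ycells_def)
      then show ?thesis using A by blast
    qed
  next
    case False
    then obtain \<sigma> d where d: "pao \<sigma> (induced_edges E \<sigma>) d" "T = label (Oriented \<sigma> d)"
      using tight_lam_pos x by blast
    show ?thesis
    proof (cases "\<sigma> = {}")
      case True
      then show ?thesis using d label_Oriented_empty by auto
    next
      case False
      then have "Oriented \<sigma> d \<in> ycells E" using d by (auto simp: ycells_def)
      then show ?thesis using d by blast
    qed
  qed
next
  fix T assume "T \<in> label ` ycells E \<union> {{Some {}}, {None, Some {}}}"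
  then consider z where "z \<in> ycells E" "T = label z" | "T = {Some {}}" | "T = {None, Some {}}"
    by blast
  then show "T \<in> tight ` polyh"
  proof cases
    case 1
    then show ?thesis
      using label_Subset_realized label_Oriented_realized by (cases z) (auto simp: ycells_def)
  next
    case 2
    then show ?thesis
      using pao_on_empty label_Oriented_empty label_Oriented_realized by metis
  next
    case 3
    then show ?thesis using label_Subset_realized[of UNIV] label_UNIV by simp
  qed
qed

lemma label_subset_iff:
  assumes "z \<in> ycells E" "z' \<in> ycells E"
  shows "label z' \<subseteq> label z \<longleftrightarrow> yle E z z'"
proof (cases z)
  case z: (Subset A)
  show ?thesis
  proof (cases z')
    case z': (Subset B)
    have "label z' \<subseteq> label z \<longleftrightarrow> (\<forall>U. U \<inter> B = {} \<longrightarrow> U \<inter> A = {})"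
      unfolding z z' by auto
    \<comment> \<open>The complement of \<open>B\<close> is the largest set avoiding
      \<open>B\<close>, so it decides the inclusion.\<close>
    also have "\<dots> \<longleftrightarrow> A \<subseteq> B" by (auto dest: spec[of _ "- B"])
    finally show ?thesis by (auto simp: z z' yle_def)
  next
    case z': (Oriented \<sigma> d)
    then have d: "pao \<sigma> (induced_edges E \<sigma>) d" using assms by (simp add: ycells_def)
    have "label z' \<subseteq> label z \<longleftrightarrow> (\<forall>U\<in>pao_ideals \<sigma> (induced_edges E \<sigma>) d. U \<inter> A = {})"
      unfolding z z' by auto
    \<comment> \<open>The largest ideal is \<open>\<sigma>\<close> itself.\<close>
    also have "\<dots> \<longleftrightarrow> \<sigma> \<inter> A = {}"
      using ideals_subset[OF d] whole_ideal[OF d] by blast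
    finally show ?thesis by (auto simp: z z' yle_def)
  qed
next
  case z: (Oriented \<sigma> d)
  show ?thesis
  proof (cases z')
    case z': (Oriented \<sigma>' d')
    have "label z' \<subseteq> label z \<longleftrightarrow>
        pao_ideals \<sigma>' (induced_edges E \<sigma>') d' \<subseteq> pao_ideals \<sigma> (induced_edges E \<sigma>) d"
      unfolding z z' by (simp add: inj_image_subset_iff)
    then show ?thesis by (auto simp: z z' yle_def)
  qed (auto simp: z yle_def)
qed

lemma label_inj: "inj_on label (ycells E)"
proof (rule inj_onI)
  fix z z' assume z: "z \<in> ycells E" "z' \<in> ycells E" "label z = label z'"
  then have le: "yle E z z'" "yle E z' z"
    using label_subset_iff[OF z(1,2)] label_subset_iff[OF z(2,1)] by simp_all
  show "z = z'"
  proof (cases z; cases z')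
    fix \<sigma> d \<sigma>' d' assume zz: "z = Oriented \<sigma> d" "z' = Oriented \<sigma>' d'"
    then have d: "pao \<sigma> (induced_edges E \<sigma>) d" "pao \<sigma>' (induced_edges E \<sigma>') d'"
      using z by (simp_all add: ycells_def)
    have J: "pao_ideals \<sigma> (induced_edges E \<sigma>) d = pao_ideals \<sigma>' (induced_edges E \<sigma>') d'"
      using z(3) zz by (simp add: inj_image_eq_iff)
    have "\<sigma> = \<sigma>'"
      using J ideals_subset[OF d(1)] whole_ideal[OF d(1)] ideals_subset[OF d(2)] whole_ideal[OF d(2)]
      by blast
    moreover have "d = d'"
      using pao_eq_if_ideals_eq[OF simple_graph_induced[OF graph], of \<sigma> d d'] d J \<open>\<sigma> = \<sigma>'\<close> by simp
    ultimately show ?thesis using zz by simp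
  qed (use le in \<open>auto simp: yle_def\<close>)
qed

section \<open>Dimensions of the cells\<close>

lemma dim_label_Subset:
  assumes "A \<noteq> {}"
  shows "int (dim {z. \<forall>c\<in>label (Subset A). normal c \<bullet> z = 0}) = ydim E (Subset A)"
proof -
  \<comment> \<open>Coordinates outside \<open>A\<close> vanish and those in \<open>A\<close> sum to
    zero: \<open>1 + card (- A)\<close> independent equations.\<close>
  define Q where "Q = insert A ((\<lambda>i. {i}) ` (- A))"
  have "{z. \<forall>c\<in>label (Subset A). normal c \<bullet> z = 0} = {w :: real^'n. \<forall>B\<in>Q. (\<Sum>i\<in>B. w $ i) = 0}"
  proof (intro equalityI subsetI)
    fix z assume z: "z \<in> {z. \<forall>c\<in>label (Subset A). normal c \<bullet> z = 0}"
    then have "normal None \<bullet> z = 0" by simp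
    then have s: "(\<Sum>i\<in>UNIV. z $ i) = 0" using N_neq by (simp add: normal_None)
    have U: "(\<Sum>i\<in>U. z $ i) = 0" if "U \<inter> A = {}" for U
      using z that normal_Some[of U z] s by auto
    have "(\<Sum>i\<in>A. z $ i) = 0"
      using s U[of "- A"] sum.union_disjoint[of A "- A" "\<lambda>i. z $ i"] by simp
    moreover have "z $ i = 0" if "i \<notin> A" for i
      using U[of "{i}"] that by simp
    ultimately show "z \<in> {w. \<forall>B\<in>Q. (\<Sum>i\<in>B. w $ i) = 0}"
      by (auto simp: Q_def)
  next
    fix z :: "real^'n" assume "z \<in> {w. \<forall>B\<in>Q. (\<Sum>i\<in>B. w $ i) = 0}"
    then have z: "(\<Sum>i\<in>A. z $ i) = 0" "\<And>i. i \<notin> A \<Longrightarrow> z $ i = 0" by (auto simp: Q_def)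
    then have s: "(\<Sum>i\<in>UNIV. z $ i) = 0"
      using sum.mono_neutral_right[of UNIV A "\<lambda>i. z $ i"] by simp
    have "(\<Sum>i\<in>U. z $ i) = 0" if "U \<inter> A = {}" for U
      using z(2) that by (intro sum.neutral) blast
    then show "z \<in> {z. \<forall>c\<in>label (Subset A). normal c \<bullet> z = 0}"
      using s by (auto simp: normal_None normal_Some)
  qed
  moreover have "disjoint Q" "{} \<notin> Q"
    using assms by (auto simp: Q_def disjoint_def)
  moreover have "card Q = 1 + card (- A)"
  proof -
    have "A \<notin> (\<lambda>i. {i}) ` (- A)" by auto
    then show ?thesis by (simp add: Q_def card_image)
  qed
  moreover have "card (- A) + card A = CARD('n)"
    by (simp add: card_Diff_subset Compl_eq_Diff_UNIV card_mono)
  ultimately show ?thesis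
    using dim_orthogonal_to_disjoint_indicators[of Q] by simp
qed

lemma dim_label_Oriented:
  assumes d: "pao \<sigma> (induced_edges E \<sigma>) d"
  shows "int (dim {z. \<forall>c\<in>label (Oriented \<sigma> d). normal c \<bullet> z = 0}) = ydim E (Oriented \<sigma> d)"
proof -
  let ?J = "pao_ideals \<sigma> (induced_edges E \<sigma>) d"
  define Q where "Q = pao_partition \<sigma> (induced_edges E \<sigma>) d"
  note g = simple_graph_induced[OF graph, of \<sigma>]
  have part: "partition_on \<sigma> Q" unfolding Q_def by (rule pao_partition_partition_on[OF g d])
  \<comment> \<open>Ideals are disjoint unions of blocks and blocks are differences of
    ideals.\<close>
  have blocks: "(\<forall>U\<in>?J. (\<Sum>i\<in>U. w $ i) = 0) \<longleftrightarrow> (\<forall>B\<in>Q. (\<Sum>i\<in>B. w $ i) = 0)" for w :: "real^'n"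
  proof (intro iffI ballI)
    fix B assume J: "\<forall>U\<in>?J. (\<Sum>i\<in>U. w $ i) = 0" and "B \<in> Q"
    then obtain U U' where U: "U \<in> ?J" "U' \<in> ?J" "U' \<subseteq> U" "U - U' = B"
      using pao_partition_ideals(2)[OF g d] unfolding Q_def by blast
    then show "(\<Sum>i\<in>B. w $ i) = 0"
      using J sum_diff[of U U' "\<lambda>i. w $ i"] by simp
  next
    fix U assume Q0: "\<forall>B\<in>Q. (\<Sum>i\<in>B. w $ i) = 0" and "U \<in> ?J"
    then obtain I where I: "I \<subseteq> Q" "U = \<Union>I"
      using pao_partition_ideals(1)[OF g d] unfolding Q_def by blast
    have "(\<Sum>i\<in>U. w $ i) = (\<Sum>B\<in>I. \<Sum>i\<in>B. w $ i)"
      unfolding I(2) using part I(1)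
      by (intro sum.Union_disjoint[unfolded comp_def]) (auto simp: partition_on_def disjoint_def)
    then show "(\<Sum>i\<in>U. w $ i) = 0" using Q0 I(1) by (simp add: subset_iff)
  qed
  \<comment> \<open>Subtracting a multiple of a point of the cell makes the equations homogeneous.\<close>
  obtain x where x: "x \<in> polyh" "tight x = label (Oriented \<sigma> d)"
    using label_Oriented_realized[OF d] by (metis imageE)
  have lam: "lam x \<noteq> 0" using None_mem_tight[of x] x(2) by auto
  define y where "y = (1 / lam x) *\<^sub>R x"
  have y_sum: "(\<Sum>i\<in>U. y $ i) = (\<Sum>i\<in>U. x $ i) / lam x" for U
    by (simp add: y_def sum_divide_distrib)
  have y: "(\<Sum>i\<in>U. y $ i) = gweight E U" if "U \<in> ?J" for U
    using Some_mem_tight[of U x] x(2) that lam by (simp add: y_sum)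
  \<comment> \<open>The linear part of \<open>lam\<close>. Since \<open>y\<close> has sum
    \<open>gweight E U\<close> on each ideal, subtracting \<open>\<epsilon> z\<close> times
    \<open>y\<close> turns the equation of \<open>U\<close> at \<open>z\<close> into a plain
    coordinate sum. The map \<open>\<Phi>\<close> is invertible because \<open>\<epsilon> y\<close>
    differs from \<open>1\<close>, by a nonzero multiple of \<open>N\<close>.\<close>
  define \<epsilon> where "\<epsilon> z = (\<Sum>i\<in>UNIV. z $ i) / (M - N)" for z :: "real^'n"
  have "\<epsilon> y = 1 + N / (lam x * (M - N))"
    unfolding \<epsilon>_def y_sum sum_eq_lam[of x] using lam N_neq
    by (simp add: add_divide_distrib)
  then have \<epsilon>_y: "\<epsilon> y \<noteq> 1" using lam N_neq N_pos by simp
  have \<epsilon>_lin: "\<epsilon> (u + v) = \<epsilon> u + \<epsilon> v" "\<epsilon> (r *\<^sub>R u) = r * \<epsilon> u" for u v r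
    by (simp_all add: \<epsilon>_def sum.distrib add_divide_distrib flip: sum_distrib_left)
  define \<Phi> where "\<Phi> z = z - \<epsilon> z *\<^sub>R y" for z
  have lin: "linear \<Phi>"
    by (rule linearI) (simp_all add: \<Phi>_def \<epsilon>_lin algebra_simps)
  have inj: "inj \<Phi>"
    unfolding linear_injective_0[OF lin]
  proof (intro allI impI)
    fix z assume "\<Phi> z = 0"
    then have z: "z = \<epsilon> z *\<^sub>R y" by (simp add: \<Phi>_def)
    then have "\<epsilon> z = \<epsilon> z * \<epsilon> y" using \<epsilon>_lin(2) by metis
    then have "\<epsilon> z = 0" using \<epsilon>_y by simp
    then show "z = 0" using z by simp
  qed
  define L where "L = {z. \<forall>c\<in>label (Oriented \<sigma> d). normal c \<bullet> z = 0}"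
  have mem_L: "z \<in> L \<longleftrightarrow> \<Phi> z \<in> {w. \<forall>B\<in>Q. (\<Sum>i\<in>B. w $ i) = 0}" for z
  proof -
    have "normal (Some U) \<bullet> z = (\<Sum>i\<in>U. \<Phi> z $ i)" if "U \<in> ?J" for U
    proof -
      have "(\<Sum>i\<in>U. \<Phi> z $ i) = (\<Sum>i\<in>U. z $ i) - \<epsilon> z * (\<Sum>i\<in>U. y $ i)"
        by (simp add: \<Phi>_def sum_subtractf flip: sum_distrib_left)
      then show ?thesis using y[OF that] by (simp add: normal_Some \<epsilon>_def)
    qed
    then have "z \<in> L \<longleftrightarrow> (\<forall>U\<in>?J. (\<Sum>i\<in>U. \<Phi> z $ i) = 0)" by (simp add: L_def)
    then show ?thesis using blocks by simp
  qed
  have "\<Phi> ` L = {w. \<forall>B\<in>Q. (\<Sum>i\<in>B. w $ i) = 0}"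
  proof (intro equalityI subsetI)
    fix w :: "real^'n" assume w: "w \<in> {w. \<forall>B\<in>Q. (\<Sum>i\<in>B. w $ i) = 0}"
    obtain z where "w = \<Phi> z"
      using linear_injective_imp_surjective[OF lin inj] by (metis surjD)
    then show "w \<in> \<Phi> ` L" using mem_L w by blast
  qed (use mem_L in blast)
  moreover have "dim (\<Phi> ` L) = dim L"
    using lin inj by (intro dim_image_eq) (auto intro: inj_on_subset)
  moreover have "disjoint Q" "{} \<notin> Q" using part by (auto simp: partition_on_def)
  ultimately have "dim L + card Q = CARD('n)"
    using dim_orthogonal_to_disjoint_indicators[of Q] by simp
  moreover have "card (UNIV - \<sigma>) + card \<sigma> = CARD('n)"
    by (simp add: card_Diff_subset card_mono)
  ultimately show ?thesis by (simp add: L_def pao_dim_def Q_def)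
qed

end

section \<open>Assembly of the realization\<close>

theorem theorem2p25:
  fixes E :: "'n::finite set set" and N :: real
  assumes "simple_graph (UNIV :: 'n set) E"
    and "connected_graph (UNIV :: 'n set) E"
    and "N > 0"
    and "N \<noteq> real (CARD('n) + card E)"
  shows "polytopal_complex (Y_complex E N) \<and>
    (\<exists>\<phi> :: (real ^ 'n) set \<Rightarrow> 'n ycell.
       bij_betw \<phi> (open_cells (Y_complex E N)) (ycells E) \<and>
       (\<forall>c \<in> open_cells (Y_complex E N). \<forall>c' \<in> open_cells (Y_complex E N).
          closure c \<subseteq> closure c' \<longleftrightarrow> yle E (\<phi> c) (\<phi> c')) \<and>
       (\<forall>c \<in> open_cells (Y_complex E N). aff_dim c = ydim E (\<phi> c)))"
proof -
  interpret graph_join E N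
    by standard (use assms in \<open>simp_all add: gweight_def\<close>)
  have Y: "Y_complex E N =
      {F. F face_of polyh \<and> F \<noteq> {} \<and> F \<noteq> polyh \<and> F \<noteq> dilated_simplex N}"
    by (simp add: Y_complex_def join_eq_polyh)
  \<comment> \<open>Each label contains a nonempty set: the complement of \<open>A\<close>, or
    \<open>\<sigma>\<close> itself. This separates the cells from the two removed faces and shows
    that only the whole polytope lies above the facet.\<close>
  have big: "\<not> label z \<subseteq> {None, Some {}}" if z: "z \<in> ycells E" for z
  proof (cases z)
    case (Subset A)
    then have "- A \<noteq> {}" "Some (- A) \<in> label z" using z by (auto simp: ycells_def)
    then show ?thesis by auto
  next
    case (Oriented \<sigma> d)
    then have "\<sigma> \<noteq> {}" "Some \<sigma> \<in> label z" using z whole_ideal by (auto simp: ycells_def)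
    then show ?thesis by auto
  qed
  have new: "{Some {}} \<notin> label ` ycells E" "{None, Some {}} \<notin> label ` ycells E"
    using big by (metis imageE order_refl subset_insertI)+
  have "Some {} \<in> tight x" for x
    by (simp add: Some_mem_tight gweight_empty[OF graph])
  then have top: "tight_face {Some {}} = polyh"
    and facet: "tight_face {None, Some {}} = dilated_simplex N"
    using lam_0_iff by (auto simp: tight_face_def None_mem_tight)
  have maximal: "T \<in> {{Some {}}, {None, Some {}}}"
    if "T \<in> tight ` polyh" "T \<subseteq> {None, Some {}}" for T
    using that(1) unfolding tight_image
  proof
    assume "T \<in> label ` ycells E"
    then show ?thesis using big that(2) by (metis imageE)
  qed
  from face_complex_realization[OF bounded_polyh label_inj tight_image new top facet maximal]
  obtain \<phi> where complex: "polytopal_complex (Y_complex E N)"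
    and bij: "bij_betw \<phi> (open_cells (Y_complex E N)) (ycells E)"
    and incl: "\<And>c c'. c \<in> open_cells (Y_complex E N) \<Longrightarrow> c' \<in> open_cells (Y_complex E N) \<Longrightarrow>
      closure c \<subseteq> closure c' \<longleftrightarrow> label (\<phi> c') \<subseteq> label (\<phi> c)"
    and dim: "\<And>c. c \<in> open_cells (Y_complex E N) \<Longrightarrow> \<exists>x\<in>polyh. tight x = label (\<phi> c) \<and>
      aff_dim c = int (dim {z. \<forall>i\<in>tight x. normal i \<bullet> z = 0})"
    unfolding Y[symmetric] by blast
  have mem: "\<phi> c \<in> ycells E" if "c \<in> open_cells (Y_complex E N)" for c
    using bij that by (rule bij_betwE[THEN bspec])
  have "aff_dim c = ydim E (\<phi> c)" if c: "c \<in> open_cells (Y_complex E N)" for c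
  proof -
    have "aff_dim c = int (dim {z. \<forall>i\<in>label (\<phi> c). normal i \<bullet> z = 0})"
      using dim[OF c] by auto
    also have "\<dots> = ydim E (\<phi> c)"
    proof (cases "\<phi> c")
      case (Subset A)
      then show ?thesis using mem[OF c] dim_label_Subset[of A] by (simp add: ycells_def)
    next
      case (Oriented \<sigma> d)
      then show ?thesis using mem[OF c] dim_label_Oriented[of \<sigma> d] by (simp add: ycells_def)
    qed
    finally show ?thesis .
  qed
  moreover have "closure c \<subseteq> closure c' \<longleftrightarrow> yle E (\<phi> c) (\<phi> c')"
    if "c \<in> open_cells (Y_complex E N)" "c' \<in> open_cells (Y_complex E N)" for c c'
    using incl[OF that] label_subset_iff[OF mem[OF that(1)] mem[OF that(2)]] by simp
  ultimately show ?thesis using complex bij by (intro conjI exI[of _ \<phi>] ballI)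
qed

end
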